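(* Let $c(x,y)=h(y-x)$ on $\mathbb{R}\times\mathbb{R}$ with $h:\mathbb{R}\to[0,\infty)$ strictly convex, and suppose $c(x,y)\le c_X(x)+c_Y(y)$ for all $x,y$, for fixed measurable $c_X,c_Y:\mathbb{R}\to\mathbb{R}$. Let $a$ and $b$ be finite signed Borel measures on $\mathbb{R}$ with equal mass, $|a|(\mathbb{R})=|b|(\mathbb{R})$, equal integral, $a(\mathbb{R})=b(\mathbb{R})$, and finite moment, $c_X\in L^1(|a|)$ and $c_Y\in L^1(|b|)$. Suppose $a$ and $b$ have finite-length signatures $(z_i)_{i=1}^n$ and $(w_i)_{i=1}^m$ respectively, with $(z_i)\ne(w_i)$. Then there is no optimal transport kernel $K$ sending $a$ to $b$, i.e. with $aK=b$.
   Context: For finite non-negative Borel measures $\mu,\nu$ on $\mathbb{R}$ of equal mass, a coupling is a non-negative measure on $\mathbb{R}\times\mathbb{R}$ with marginals $\mu,\nu$; it is optimal if it minimizes $\int c\,d\gamma$ among all couplings; $C(\mu,\nu)$ is the infimum. A signed measure $a$ with Jordan decomposition $a=a^+-a^-$ has finite-length signature if it has finite mass and there are $n\ge1$ and points $-\infty=p_0<p_1<\dots<p_n=\infty$ (with $(p_{n-1},p_n]$ read as $(p_{n-1},\infty)$) such that $a=\sum_{i=1}^n a^i$, where the $a^i$ are mutually singular, each $a^i$ is carried by $(p_{i-1},p_i]$ and equals either $a^+\restriction_{(p_{i-1},p_i]}$ or $-a^-\restriction_{(p_{i-1},p_i]}$, and $a^i$ has opposite sign to $a^{i-1}$ and $a^{i+1}$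 when they exist (opposite signs in particular being strict: such $a^i$ are nonzero). The signature of $a$ is $(z_1,\dots,z_n)$ with $z_i:=a((p_{i-1},p_i])$. Optimal transport kernels (for $c$, with $X=Y=\mathbb{R}$) are of the following kinds. (i) A Markov kernel $K$ from $X$ to $Y$ (measurable in $x$, a probability measure on $Y$ for each $x$), acting on finite (signed) measures by $\mu K(B)=\int_X K(x,B)\,d\mu(x)$ and $\mu\odot K(A\times B)=\int_A K(x,B)\,d\mu(x)$, such that for every finite non-negative $\mu$ with $C(\mu,\mu K)<\infty$, $\mu\odot K$ is an optimal coupling between $\mu$ and $\mu K$. (ii) The kernel $K^\gamma$ associated to an optimal coupling $\gamma$ of finite non-negative measures $\mu$ on $X$ and $\nu$ on $Y$ with $c_X\in L^1(\mu)$, $c_Y\in L^1(\nu)$: it is defined only on finite (signed) measures $\eta\ll\mu$ with bounded density $\frac{d\eta}{d\mu}$ and $c_X\in L^1(|\eta|)$, by $d(\eta\odot K^\gamma)(x,y)=\frac{d\eta}{d\mu}(x)\,d\gamma(x,y)$ and $\eta K^\gamma=(\operatorname{proj}_Y)_\#(\eta\odot K^\gamma)$. Writing $aK$ presupposes that $a$ is in the domain of $K$. *)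

theory Defs
  imports "HOL-Probability.Probability"
begin

section \<open>Finite signed Borel measures on the line\<close>

text \<open>
  A finite signed Borel measure is a countably additive real-valued set function on the Borel sets;
  its values on non-Borel sets are irrelevant, so two of them are compared on Borel sets only.
\<close>

definition signed_measure :: "(real set \<Rightarrow> real) \<Rightarrow> bool" where
  "signed_measure a \<longleftrightarrow> a {} = 0 \<and>
     (\<forall>A :: nat \<Rightarrow> real set. range A \<subseteq> sets borel \<longrightarrow> disjoint_family A \<longrightarrow>
        (\<lambda>i. a (A i)) sums a (\<Union>i. A i))"

definition fin_borel_measure :: "real measure \<Rightarrow> bool" where
  "fin_borel_measure \<mu> \<longleftrightarrow> sets \<mu> = sets borel \<and> finite_measure \<mu>"

definition jordan_decomposition :: "(real set \<Rightarrow> real) \<Rightarrow> real measure \<Rightarrow> real measure \<Rightarrow> bool" where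
  "jordan_decomposition a P N \<longleftrightarrow>
     fin_borel_measure P \<and> fin_borel_measure N \<and>
     (\<exists>A\<in>sets borel. emeasure P (- A) = 0 \<and> emeasure N A = 0) \<and>
     (\<forall>B\<in>sets borel. a B = measure P B - measure N B)"

lemma jordan_decomposition_le:
  assumes "jordan_decomposition a P N" "jordan_decomposition a P' N'" and B: "B \<in> sets borel"
  shows "emeasure P B \<le> emeasure P' B"
proof -
  from assms(1) obtain A where A: "A \<in> sets borel" "emeasure P (- A) = 0" "emeasure N A = 0"
    and P: "finite_measure P" "sets P = sets borel" and N: "finite_measure N" "sets N = sets borel"
    and a: "\<And>B. B \<in> sets borel \<Longrightarrow> a B = measure P B - measure N B"
    by (auto simp: jordan_decomposition_def fin_borel_measure_def)
  from assms(2) have P': "finite_measure P'" "sets P' = sets borel"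
    and a': "\<And>B. B \<in> sets borel \<Longrightarrow> a B = measure P' B - measure N' B"
    by (auto simp: jordan_decomposition_def fin_borel_measure_def)
  interpret P: finite_measure P by fact
  interpret N: finite_measure N by fact
  interpret P': finite_measure P' by fact
  have "emeasure N (B \<inter> A) \<le> emeasure N A" by (rule emeasure_mono) (use A N in auto)
  then have N0: "measure N (B \<inter> A) = 0" using A by (simp add: measure_def)
  have "emeasure P (B - A) \<le> emeasure P (- A)" by (rule emeasure_mono) (use A P in auto)
  then have "measure P (B - A) = 0" using A by (simp add: measure_def)
  moreover have "measure P B = measure P (B \<inter> A) + measure P (B - A)"
    using P.finite_measure_Union[of "B \<inter> A" "B - A"] A B P by (simp add: Int_Diff_Un disjoint_iff)
  ultimately have "measure P B = a (B \<inter> A)" using a[of "B \<inter> A"] A B N0 by simp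
  also have "\<dots> \<le> measure P' (B \<inter> A)" using a'[of "B \<inter> A"] A B by simp
  also have "\<dots> \<le> measure P' B" by (rule P'.finite_measure_mono) (use A B P' in auto)
  finally show ?thesis by (simp add: P.emeasure_eq_measure P'.emeasure_eq_measure)
qed

lemma jordan_decomposition_minus:
  assumes "jordan_decomposition a P N"
  shows "jordan_decomposition (\<lambda>B. - a B) N P"
proof -
  obtain A where "A \<in> sets borel" "emeasure P (- A) = 0" "emeasure N A = 0"
    using assms unfolding jordan_decomposition_def by blast
  then have "\<exists>A\<in>sets borel. emeasure N (- A) = 0 \<and> emeasure P A = 0"
    by (intro bexI[of _ "- A"]) auto
  then show ?thesis using assms by (simp add: jordan_decomposition_def)
qed

lemma jordan_decomposition_unique:
  assumes "jordan_decomposition a P N" "jordan_decomposition a P' N'"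
  shows "P = P'" "N = N'"
proof -
  have *: "P = P'" if "jordan_decomposition a P N" "jordan_decomposition a P' N'" for a P N P' N'
  proof (rule measure_eqI)
    show "sets P = sets P'"
      using that by (simp add: jordan_decomposition_def fin_borel_measure_def)
    fix B assume "B \<in> sets P"
    then have "B \<in> sets borel"
      using that by (simp add: jordan_decomposition_def fin_borel_measure_def)
    then show "emeasure P B = emeasure P' B"
      using jordan_decomposition_le that by (meson antisym)
  qed
  show "P = P'" "N = N'"
    using * assms jordan_decomposition_minus by blast+
qed

lemma signed_measure_sums:
  assumes "signed_measure a" "\<And>i :: nat. A i \<in> sets borel" "disjoint_family A"
  shows "(\<lambda>i. a (A i)) sums a (\<Union>i. A i)"
proof -
  have "range A \<subseteq> sets borel" using assms(2) by (rule image_subsetI)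
  then show ?thesis using assms(1,3) unfolding signed_measure_def by blast
qed

lemma signed_measure_Un:
  assumes a: "signed_measure a" and "A \<in> sets borel" "B \<in> sets borel" "A \<inter> B = {}"
  shows "a (A \<union> B) = a A + a B"
proof -
  have "(\<lambda>i. a (binaryset A B i)) sums a (\<Union>i. binaryset A B i)"
  proof (rule signed_measure_sums[OF a])
    show "binaryset A B i \<in> sets borel" for i
      using assms(2,3) by (simp add: binaryset_def)
    show "disjoint_family (binaryset A B)"
      using assms(4) by (simp add: disjoint_family_on_def binaryset_def inf_commute)
  qed
  moreover have "(\<lambda>i. a (binaryset A B i)) sums (a A + a B)"
    by (rule binaryset_sums) (use a in \<open>simp add: signed_measure_def\<close>)
  ultimately show ?thesis by (metis UN_binaryset_eq sums_unique2)
qed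

lemma signed_measure_Diff:
  assumes a: "signed_measure a" and "A \<in> sets borel" "B \<in> sets borel" "B \<subseteq> A"
  shows "a (A - B) = a A - a B"
  using signed_measure_Un[OF a, of "A - B" B] assms by (simp add: Un_absorb2 inf_commute)

lemma signed_measure_incseq:
  assumes a: "signed_measure a" and A: "\<And>n. A n \<in> sets borel" "incseq A"
  shows "(\<lambda>n. a (A n)) \<longlonglongrightarrow> a (\<Union>n. A n)"
proof -
  have "(\<lambda>i. a (disjointed A i)) sums a (\<Union>i. disjointed A i)"
  proof (rule signed_measure_sums[OF a _ disjoint_family_disjointed])
    show "disjointed A i \<in> sets borel" for i
      unfolding disjointed_def using A(1) by (intro sets.Diff sets.finite_UN) auto
  qed
  then have "(\<lambda>n. \<Sum>i<Suc n. a (disjointed A i)) \<longlonglongrightarrow> a (\<Union>n. A n)"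
    unfolding UN_disjointed_eq sums_def by (rule LIMSEQ_Suc)
  moreover have "(\<Sum>i<Suc n. a (disjointed A i)) = a (A n)" for n
  proof (induction n)
    case 0 show ?case by simp
  next
    case (Suc n)
    have "A n \<subseteq> A (Suc n)" using A(2) by (simp add: incseq_SucD)
    moreover have "disjointed A (Suc n) = A (Suc n) - A n"
      using A(2) disjointed_mono[of A n] by (simp add: mono_iff_le_Suc)
    ultimately show ?case using Suc signed_measure_Diff[OF a A(1) A(1)] by simp
  qed
  ultimately show ?thesis by simp
qed

lemma signed_measure_decseq:
  assumes a: "signed_measure a" and A: "\<And>n. A n \<in> sets borel" "decseq A"
  shows "(\<lambda>n. a (A n)) \<longlonglongrightarrow> a (\<Inter>n. A n)"
proof -
  have c: "a (- B) = a UNIV - a B" if "B \<in> sets borel" for B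
    unfolding Compl_eq_Diff_UNIV by (rule signed_measure_Diff[OF a _ that]) simp_all
  have "(\<lambda>n. a (- A n)) \<longlonglongrightarrow> a (\<Union>n. - A n)"
  proof (rule signed_measure_incseq[OF a])
    show "- A n \<in> sets borel" for n using A(1) by (rule borel_comp)
    show "incseq (\<lambda>n. - A n)" using A(2) by (simp add: incseq_def decseq_def)
  qed
  moreover have "(\<Union>n. - A n) = - (\<Inter>n. A n)" by blast
  ultimately have "(\<lambda>n. a UNIV - a (- A n)) \<longlonglongrightarrow> a UNIV - a (- (\<Inter>n. A n))"
    using tendsto_diff[OF tendsto_const] by metis
  moreover have "(\<Inter>n. A n) \<in> sets borel"
    by (rule sets.countable_INT') (use A(1) in auto)
  ultimately show ?thesis by (simp only: c A(1)) simp
qed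

lemma signed_measure_almost_positive_subset:
  assumes a: "signed_measure a" and E: "E \<in> sets borel" and e: "e > 0"
  shows "\<exists>A\<in>sets borel. A \<subseteq> E \<and> a E \<le> a A \<and> (\<forall>B\<in>sets borel. B \<subseteq> A \<longrightarrow> - e < a B)"
proof (rule ccontr)
  assume neg: "\<not> ?thesis"
  define good where "good A \<longleftrightarrow> A \<in> sets borel \<and> A \<subseteq> E \<and> a E \<le> a A" for A
  have ex: "\<exists>B\<in>sets borel. B \<subseteq> A \<and> a B \<le> - e" if "good A" for A
    using neg that unfolding good_def by (meson not_le)
  then obtain f where f: "\<And>A. good A \<Longrightarrow> f A \<in> sets borel \<and> f A \<subseteq> A \<and> a (f A) \<le> - e"
    by metis
  define A where "A = rec_nat E (\<lambda>_ X. X - f X)"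
  have A0: "A 0 = E" and AS: "A (Suc n) = A n - f (A n)" for n by (auto simp: A_def)
  have good: "good (A n)" for n
  proof (induction n)
    case 0 then show ?case using E by (simp add: A0 good_def)
  next
    case (Suc n)
    have "a (A (Suc n)) = a (A n) - a (f (A n))"
      unfolding AS using f[OF Suc] Suc by (intro signed_measure_Diff[OF a]) (auto simp: good_def)
    then show ?case using Suc f[OF Suc] e by (auto simp: good_def AS)
  qed
  have dec: "A n \<subseteq> A m" if "m \<le> n" for m n
    using that by (induction rule: dec_induct) (auto simp: AS)
  have "disjoint_family (\<lambda>n. f (A n))"
    unfolding disjoint_family_on_def
  proof (intro ballI impI)
    fix m n :: nat assume "m \<noteq> n"
    have *: "f (A m) \<inter> f (A n) = {}" if "m < n" for m n
      using dec[of "Suc m" n] f[OF good[of n]] that by (auto simp: AS)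
    show "f (A m) \<inter> f (A n) = {}"
      using *[of m n] *[of n m] \<open>m \<noteq> n\<close> by (cases "m < n") auto
  qed
  moreover have "f (A n) \<in> sets borel" for n using f[OF good] by blast
  ultimately have "summable (\<lambda>n. a (f (A n)))"
    using signed_measure_sums[OF a, of "\<lambda>n. f (A n)"] sums_summable by blast
  then have "(\<lambda>n. a (f (A n))) \<longlonglongrightarrow> 0" by (rule summable_LIMSEQ_zero)
  then have "0 \<le> - e" by (rule LIMSEQ_le_const2) (use f good in auto)
  then show False using e by simp
qed

lemma signed_measure_positive_subset:
  assumes a: "signed_measure a" and E: "E \<in> sets borel"
  shows "\<exists>A\<in>sets borel. A \<subseteq> E \<and> a E \<le> a A \<and> (\<forall>B\<in>sets borel. B \<subseteq> A \<longrightarrow> 0 \<le> a B)"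
proof -
  have "\<exists>A\<in>sets borel. A \<subseteq> X \<and> a X \<le> a A \<and>
      (\<forall>B\<in>sets borel. B \<subseteq> A \<longrightarrow> - inverse (real (Suc n)) < a B)" if "X \<in> sets borel" for X n
    using signed_measure_almost_positive_subset[OF a that, of "inverse (real (Suc n))"] by simp
  then obtain f where f: "\<And>X n. X \<in> sets borel \<Longrightarrow> f X n \<in> sets borel \<and> f X n \<subseteq> X \<and> a X \<le> a (f X n) \<and>
      (\<forall>B\<in>sets borel. B \<subseteq> f X n \<longrightarrow> - inverse (real (Suc n)) < a B)"
    by metis
  define A where "A = rec_nat E (\<lambda>n X. f X n)"
  have A0: "A 0 = E" and AS: "A (Suc n) = f (A n) n" for n by (auto simp: A_def)
  have Ab: "A n \<in> sets borel" for n
    by (induction n) (use E f in \<open>simp_all add: A0 AS\<close>)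
  have sub: "A (Suc n) \<subseteq> A n" for n using f[OF Ab] by (simp add: AS)
  have mono: "a E \<le> a (A n)" for n
  proof (induction n)
    case (Suc n)
    have "a (A n) \<le> a (A (Suc n))" using f[OF Ab[of n], of n] by (simp add: AS)
    with Suc show ?case by simp
  qed (simp add: A0)
  have "(\<lambda>n. a (A n)) \<longlonglongrightarrow> a (\<Inter>n. A n)"
    by (rule signed_measure_decseq[OF a Ab], rule decseq_SucI, rule sub)
  then have "a E \<le> a (\<Inter>n. A n)" by (rule LIMSEQ_le_const) (use mono in auto)
  moreover have "0 \<le> a B" if B: "B \<in> sets borel" "B \<subseteq> (\<Inter>n. A n)" for B
  proof -
    have "- inverse (real (Suc n)) \<le> a B" for n
    proof -
      have "B \<subseteq> f (A n) n" using B(2) by (auto simp flip: AS)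
      then have "- inverse (real (Suc n)) < a B" using f[OF Ab[of n], of n] B(1) by blast
      then show ?thesis by simp
    qed
    moreover have "(\<lambda>n. - inverse (real (Suc n))) \<longlonglongrightarrow> - 0"
      by (intro tendsto_minus LIMSEQ_inverse_real_of_nat)
    ultimately have "- 0 \<le> a B" by (intro LIMSEQ_le_const2) auto
    then show ?thesis by simp
  qed
  moreover have "(\<Inter>n. A n) \<in> sets borel"
    by (rule sets.countable_INT') (use Ab in auto)
  moreover have "(\<Inter>n. A n) \<subseteq> E" using A0 by blast
  ultimately show ?thesis by blast
qed

lemma hahn_decomposition:
  assumes a: "signed_measure a"
  shows "\<exists>P\<in>sets borel. (\<forall>B\<in>sets borel. B \<subseteq> P \<longrightarrow> 0 \<le> a B) \<and> (\<forall>B\<in>sets borel. B \<subseteq> - P \<longrightarrow> a B \<le> 0)"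
proof -
  let ?pos = "\<lambda>P. P \<in> sets borel \<and> (\<forall>B\<in>sets borel. B \<subseteq> P \<longrightarrow> 0 \<le> a B)"
  have union: "?pos (\<Union>n. A n) \<and> (\<forall>n. a (A n) \<le> a (\<Union>n. A n))"
    if A: "\<And>n. ?pos (A n)" for A :: "nat \<Rightarrow> real set"
  proof -
    have b: "(\<Union>n. A n) \<in> sets borel" by (rule sets.countable_UN') (use A in auto)
    have pos: "0 \<le> a B" if B: "B \<in> sets borel" "B \<subseteq> (\<Union>n. A n)" for B
    proof -
      let ?D = "\<lambda>n. B \<inter> disjointed A n"
      have D: "disjointed A n \<in> sets borel" for n
        unfolding disjointed_def using A by (intro sets.Diff sets.finite_UN) blast+
      have "?D n \<in> sets borel" for n using D B(1) by (rule sets.Int[rotated])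
      moreover have "disjoint_family ?D"
        using disjoint_family_disjointed[of A] by (auto simp: disjoint_family_on_def)
      ultimately have "(\<lambda>n. a (?D n)) sums a (\<Union>n. ?D n)"
        using signed_measure_sums[OF a, of ?D] by blast
      moreover have "(\<Union>n. ?D n) = B" using B(2) UN_disjointed_eq[of A] by auto
      moreover have "0 \<le> a (?D n)" for n
      proof -
        have "?D n \<in> sets borel" using D B(1) by blast
        moreover have "?D n \<subseteq> A n" using disjointed_subset[of A n] by blast
        ultimately show ?thesis using A[of n] by blast
      qed
      ultimately show ?thesis using sums_le[OF _ sums_zero] by metis
    qed
    moreover have "a (A n) \<le> a (\<Union>n. A n)" for n
    proof -
      have "a ((\<Union>n. A n) - A n) = a (\<Union>n. A n) - a (A n)"
        by (rule signed_measure_Diff[OF a b]) (use A in blast)+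
      moreover have "0 \<le> a ((\<Union>n. A n) - A n)" by (rule pos) (use b A in blast)+
      ultimately show ?thesis by simp
    qed
    ultimately show ?thesis using b by blast
  qed
  have approx: "\<exists>A. ?pos A \<and> a E \<le> a A" if "E \<in> sets borel" for E
    using signed_measure_positive_subset[OF a that] by blast
  have bdd: "bdd_above (a ` sets borel)"
  proof (rule ccontr)
    assume "\<not> ?thesis"
    then have "\<exists>E\<in>sets borel. real n < a E" for n
    proof (rule contrapos_np)
      assume "\<not> (\<exists>E\<in>sets borel. real n < a E)"
      then show "bdd_above (a ` sets borel)" by (intro bdd_aboveI2[of _ _ "real n"]) (simp add: not_less)
    qed
    then have "\<exists>A. ?pos A \<and> real n < a A" for n using approx by (meson less_le_trans)
    then obtain A where A: "\<And>n. ?pos (A n)" "\<And>n. real n < a (A n)" by metis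
    have "real n < a (\<Union>n. A n)" for n
      using union[of A, OF A(1)] A(2)[of n] less_le_trans by blast
    then show False using reals_Archimedean2[of "a (\<Union>n. A n)"] less_asym by blast
  qed
  define s where "s = (SUP E\<in>sets borel. a E)"
  have le: "a E \<le> s" if "E \<in> sets borel" for E
    unfolding s_def by (rule cSUP_upper[OF that bdd])
  have "\<exists>E\<in>sets borel. s - inverse (real (Suc n)) < a E" for n
  proof -
    have "s - inverse (real (Suc n)) < s" by simp
    then show ?thesis unfolding s_def by (subst (asm) less_cSUP_iff[OF _ bdd]) auto
  qed
  then have "\<exists>A. ?pos A \<and> s - inverse (real (Suc n)) < a A" for n
    using approx by (meson less_le_trans)
  then obtain A where A: "\<And>n. ?pos (A n)" "\<And>n. s - inverse (real (Suc n)) < a (A n)" by metis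
  define P where "P = (\<Union>n. A n)"
  have P: "?pos P" and AP: "a (A n) \<le> a P" for n
    using union[of A, OF A(1)] unfolding P_def by blast+
  have "s - inverse (real (Suc n)) \<le> a P" for n
    using A(2)[of n] AP[of n] by linarith
  moreover have "(\<lambda>n. s - inverse (real (Suc n))) \<longlonglongrightarrow> s - 0"
    by (intro tendsto_intros LIMSEQ_inverse_real_of_nat)
  ultimately have "s - 0 \<le> a P" by (intro LIMSEQ_le_const2) auto
  then have sP: "s \<le> a P" by simp
  have "a B \<le> 0" if B: "B \<in> sets borel" "B \<subseteq> - P" for B
  proof -
    have "a (P \<union> B) = a P + a B" by (rule signed_measure_Un[OF a]) (use P B in blast)+
    moreover have "a (P \<union> B) \<le> s" by (rule le) (use P B in blast)
    ultimately show ?thesis using sP by linarith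
  qed
  then show ?thesis using P by blast
qed

lemma signed_measure_restrict_measure:
  assumes a: "signed_measure a" and P: "P \<in> sets borel"
    and pos: "\<And>B. B \<in> sets borel \<Longrightarrow> B \<subseteq> P \<Longrightarrow> 0 \<le> a B"
  shows "\<exists>M. fin_borel_measure M \<and> (\<forall>B\<in>sets borel. emeasure M B = ennreal (a (B \<inter> P)))"
proof -
  define M where "M = measure_of UNIV (sets borel) (\<lambda>B. ennreal (a (B \<inter> P)))"
  have sets: "sets M = sets borel"
    unfolding M_def using sets.sigma_sets_eq[of borel] by (simp add: sets_measure_of_conv)
  have em: "emeasure M B = ennreal (a (B \<inter> P))" if B: "B \<in> sets borel" for B
  proof (rule emeasure_measure_of[OF M_def])
    show "positive (sets M) (\<lambda>B. ennreal (a (B \<inter> P)))"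
      using a by (simp add: positive_def signed_measure_def)
    show "countably_additive (sets M) (\<lambda>B. ennreal (a (B \<inter> P)))"
    proof (rule countably_additiveI)
      fix A :: "nat \<Rightarrow> real set"
      assume A: "range A \<subseteq> sets M" "disjoint_family A"
      then have Ab: "A n \<in> sets borel" for n using sets by auto
      have "A n \<inter> P \<in> sets borel" for n using Ab P by (rule sets.Int)
      moreover have "disjoint_family (\<lambda>n. A n \<inter> P)"
        using A(2) by (auto simp: disjoint_family_on_def)
      ultimately have "(\<lambda>n. a (A n \<inter> P)) sums a (\<Union>n. A n \<inter> P)"
        using signed_measure_sums[OF a, of "\<lambda>n. A n \<inter> P"] by blast
      moreover have "0 \<le> a (A n \<inter> P)" for n using pos Ab P by auto
      ultimately show "(\<Sum>n. ennreal (a (A n \<inter> P))) = ennreal (a ((\<Union>n. A n) \<inter> P))"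
        by (simp add: suminf_ennreal2 sums_summable sums_unique[symmetric])
    qed
  qed (use sets B in auto)
  have "space M = UNIV" using sets_eq_imp_space_eq[OF sets] by simp
  then have "finite_measure M" by (intro finite_measureI) (simp add: em)
  then show ?thesis using sets em by (auto simp: fin_borel_measure_def)
qed

lemma jordan_decomposition_exists:
  assumes a: "signed_measure a"
  shows "\<exists>P N. jordan_decomposition a P N"
proof -
  obtain H where H: "H \<in> sets borel" "\<And>B. B \<in> sets borel \<Longrightarrow> B \<subseteq> H \<Longrightarrow> 0 \<le> a B"
    "\<And>B. B \<in> sets borel \<Longrightarrow> B \<subseteq> - H \<Longrightarrow> a B \<le> 0"
    using hahn_decomposition[OF a] by blast
  have a': "signed_measure (\<lambda>B. - a B)"
    using a by (auto simp: signed_measure_def intro: sums_minus)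
  obtain P where P: "fin_borel_measure P" "\<forall>B\<in>sets borel. emeasure P B = ennreal (a (B \<inter> H))"
    using signed_measure_restrict_measure[OF a H(1,2)] by blast
  obtain N where N: "fin_borel_measure N"
      "\<forall>B\<in>sets borel. emeasure N B = ennreal (- a (B \<inter> - H))"
    using signed_measure_restrict_measure[OF a', of "- H"] H by auto
  have "a B = measure P B - measure N B" if B: "B \<in> sets borel" for B
  proof -
    have "measure P B = a (B \<inter> H)" "measure N B = - a (B \<inter> - H)"
      using P N H B by (auto simp: measure_def)
    moreover have "a B = a (B \<inter> H) + a (B \<inter> - H)"
      using signed_measure_Un[OF a, of "B \<inter> H" "B \<inter> - H"] B H
      by (simp add: disjoint_iff flip: Int_Un_distrib)
    ultimately show ?thesis by simp
  qed
  moreover have "a {} = 0" using a by (simp add: signed_measure_def)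
  ultimately have "jordan_decomposition a P N"
    unfolding jordan_decomposition_def using P N H by (auto intro!: bexI[of _ H])
  then show ?thesis by blast
qed

definition pos_part :: "(real set \<Rightarrow> real) \<Rightarrow> real measure" where
  "pos_part a = (THE P. \<exists>N. jordan_decomposition a P N)"

definition neg_part :: "(real set \<Rightarrow> real) \<Rightarrow> real measure" where
  "neg_part a = (THE N. \<exists>P. jordan_decomposition a P N)"

lemma jordan_decomposition_parts:
  assumes "signed_measure a"
  shows "jordan_decomposition a (pos_part a) (neg_part a)"
proof -
  obtain P N where J: "jordan_decomposition a P N"
    using jordan_decomposition_exists[OF assms] by blast
  have "pos_part a = P" "neg_part a = N"
    unfolding pos_part_def neg_part_def
    using J jordan_decomposition_unique by (blast intro: the_equality)+
  then show ?thesis using J by simp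
qed

definition total_variation :: "(real set \<Rightarrow> real) \<Rightarrow> real measure" where
  "total_variation a =
     measure_of UNIV (sets borel) (\<lambda>B. emeasure (pos_part a) B + emeasure (neg_part a) B)"

lemma sets_total_variation [simp]: "sets (total_variation a) = sets borel"
  unfolding total_variation_def
  using sets.sigma_sets_eq[of borel] by (simp add: sets_measure_of_conv)

lemma emeasure_total_variation:
  assumes a: "signed_measure a" and B: "B \<in> sets borel"
  shows "emeasure (total_variation a) B = emeasure (pos_part a) B + emeasure (neg_part a) B"
proof (rule emeasure_measure_of[OF total_variation_def])
  have s: "sets (pos_part a) = sets borel" "sets (neg_part a) = sets borel"
    using jordan_decomposition_parts[OF a]
    by (auto simp: jordan_decomposition_def fin_borel_measure_def)
  show "countably_additive (sets (total_variation a))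
      (\<lambda>B. emeasure (pos_part a) B + emeasure (neg_part a) B)"
    by (rule countably_additiveI) (simp add: s suminf_add[symmetric] suminf_emeasure)
qed (use B in \<open>auto simp: positive_def\<close>)

definition signed_integral :: "(real set \<Rightarrow> real) \<Rightarrow> (real \<Rightarrow> real) \<Rightarrow> real" where
  "signed_integral a f = integral\<^sup>L (pos_part a) f - integral\<^sup>L (neg_part a) f"


section \<open>Signatures\<close>

definition vanishes_on :: "(real set \<Rightarrow> real) \<Rightarrow> real set \<Rightarrow> bool" where
  "vanishes_on a A \<longleftrightarrow> (\<forall>B\<in>sets borel. B \<subseteq> A \<longrightarrow> a B = 0)"

definition signed_mutually_singular :: "(real set \<Rightarrow> real) \<Rightarrow> (real set \<Rightarrow> real) \<Rightarrow> bool" where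
  "signed_mutually_singular a b \<longleftrightarrow> (\<exists>A\<in>sets borel. vanishes_on a (- A) \<and> vanishes_on b A)"

definition strictly_positive :: "(real set \<Rightarrow> real) \<Rightarrow> bool" where
  "strictly_positive a \<longleftrightarrow> (\<forall>B\<in>sets borel. 0 \<le> a B) \<and> (\<exists>B\<in>sets borel. a B \<noteq> 0)"

definition opposite_sign :: "(real set \<Rightarrow> real) \<Rightarrow> (real set \<Rightarrow> real) \<Rightarrow> bool" where
  "opposite_sign a b \<longleftrightarrow>
     (strictly_positive a \<and> strictly_positive (\<lambda>B. - b B)) \<or>
     (strictly_positive (\<lambda>B. - a B) \<and> strictly_positive b)"

text \<open>
  The half-open interval \<open>(s, t]\<close> in the line, with extended real endpoints; for \<open>t = \<infinity>\<close> it is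
  \<open>(s, \<infinity>)\<close>.
\<close>

definition ereal_Ioc :: "ereal \<Rightarrow> ereal \<Rightarrow> real set" where
  "ereal_Ioc s t = {x. s < ereal x \<and> ereal x \<le> t}"

text \<open>
  The pieces are indexed from \<open>0\<close>: piece \<open>i < n\<close> lives on \<open>(p i, p (Suc i)]\<close>. For \<open>n = 1\<close> there
  are no neighbouring pieces, so the single piece is allowed to be zero.
\<close>

definition has_signature :: "(real set \<Rightarrow> real) \<Rightarrow> real list \<Rightarrow> bool" where
  "has_signature a z \<longleftrightarrow>
     (\<exists>n\<ge>1. \<exists>(p :: nat \<Rightarrow> ereal) (d :: nat \<Rightarrow> real set \<Rightarrow> real).
        p 0 = -\<infinity> \<and> p n = \<infinity> \<and> (\<forall>i<n. p i < p (Suc i)) \<and>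
        (\<forall>B\<in>sets borel. a B = (\<Sum>i<n. d i B)) \<and>
        (\<forall>i<n. \<forall>j<n. i \<noteq> j \<longrightarrow> signed_mutually_singular (d i) (d j)) \<and>
        (\<forall>i<n. vanishes_on (d i) (- ereal_Ioc (p i) (p (Suc i)))) \<and>
        (\<forall>i<n.
          (\<forall>B\<in>sets borel. d i B = measure (pos_part a) (B \<inter> ereal_Ioc (p i) (p (Suc i)))) \<or>
          (\<forall>B\<in>sets borel. d i B = - measure (neg_part a) (B \<inter> ereal_Ioc (p i) (p (Suc i))))) \<and>
        (\<forall>i. Suc i < n \<longrightarrow> opposite_sign (d i) (d (Suc i))) \<and>
        z = map (\<lambda>i. a (ereal_Ioc (p i) (p (Suc i)))) [0..<n])"


section \<open>Optimal couplings\<close>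

definition is_coupling :: "real measure \<Rightarrow> real measure \<Rightarrow> (real \<times> real) measure \<Rightarrow> bool" where
  "is_coupling \<mu> \<nu> \<gamma> \<longleftrightarrow>
     sets \<gamma> = sets (borel \<Otimes>\<^sub>M borel) \<and> distr \<gamma> borel fst = \<mu> \<and> distr \<gamma> borel snd = \<nu>"

text \<open>The cost function is non-negative, so its integral is taken in \<open>[0, \<infinity>]\<close>.\<close>

definition coupling_cost :: "(real \<Rightarrow> real \<Rightarrow> real) \<Rightarrow> (real \<times> real) measure \<Rightarrow> ennreal" where
  "coupling_cost c \<gamma> = (\<integral>\<^sup>+z. ennreal (c (fst z) (snd z)) \<partial>\<gamma>)"

definition transport_cost :: "(real \<Rightarrow> real \<Rightarrow> real) \<Rightarrow> real measure \<Rightarrow> real measure \<Rightarrow> ennreal" where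
  "transport_cost c \<mu> \<nu> = (INF \<gamma>\<in>{\<gamma>. is_coupling \<mu> \<nu> \<gamma>}. coupling_cost c \<gamma>)"

definition optimal_coupling ::
    "(real \<Rightarrow> real \<Rightarrow> real) \<Rightarrow> real measure \<Rightarrow> real measure \<Rightarrow> (real \<times> real) measure \<Rightarrow> bool" where
  "optimal_coupling c \<mu> \<nu> \<gamma> \<longleftrightarrow>
     is_coupling \<mu> \<nu> \<gamma> \<and> (\<forall>\<gamma>'. is_coupling \<mu> \<nu> \<gamma>' \<longrightarrow> coupling_cost c \<gamma> \<le> coupling_cost c \<gamma>')"


section \<open>Optimal transport kernels\<close>

text \<open>
  \<open>Coupling_Kernel \<gamma>\<close> is the kernel associated to \<open>\<gamma>\<close> as a coupling of its two marginals.
\<close>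

datatype transport_kernel =
    Markov_Kernel "real \<Rightarrow> real measure"
  | Coupling_Kernel "(real \<times> real) measure"

definition kernel_product :: "real measure \<Rightarrow> (real \<Rightarrow> real measure) \<Rightarrow> (real \<times> real) measure" where
  "kernel_product \<mu> K = \<mu> \<bind> (\<lambda>x. distr (K x) (borel \<Otimes>\<^sub>M borel) (Pair x))"

lemma emeasure_kernel_product:
  assumes \<mu>: "sets \<mu> = sets borel" and K: "K \<in> borel \<rightarrow>\<^sub>M prob_algebra borel"
    and A: "A \<in> sets borel" and B: "B \<in> sets borel"
  shows "emeasure (kernel_product \<mu> K) (A \<times> B) = (\<integral>\<^sup>+x. indicator A x * emeasure (K x) B \<partial>\<mu>)"
proof -
  have K': "K \<in> borel \<rightarrow>\<^sub>M subprob_algebra borel"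
    using K by (rule measurable_prob_algebraD)
  have sK: "sets (K x) = sets borel" for x
    using measurable_space[OF K] by (simp add: space_prob_algebra)
  have meas: "(\<lambda>x. distr (K x) (borel \<Otimes>\<^sub>M borel) (Pair x)) \<in> \<mu> \<rightarrow>\<^sub>M subprob_algebra (borel \<Otimes>\<^sub>M borel)"
    unfolding measurable_cong_sets[OF \<mu> refl]
    by (rule measurable_distr2[OF _ K']) simp
  have "space \<mu> \<noteq> {}" using sets_eq_imp_space_eq[OF \<mu>] by simp
  then have "emeasure (kernel_product \<mu> K) (A \<times> B) =
      (\<integral>\<^sup>+x. emeasure (distr (K x) (borel \<Otimes>\<^sub>M borel) (Pair x)) (A \<times> B) \<partial>\<mu>)"
    unfolding kernel_product_def using meas A B by (intro emeasure_bind) auto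
  also have "\<dots> = (\<integral>\<^sup>+x. indicator A x * emeasure (K x) B \<partial>\<mu>)"
  proof (rule nn_integral_cong)
    fix x
    have m: "Pair x \<in> K x \<rightarrow>\<^sub>M borel \<Otimes>\<^sub>M borel"
      unfolding measurable_cong_sets[OF sK refl] by simp
    have "space (K x) = UNIV" using sets_eq_imp_space_eq[OF sK] by simp
    then show "emeasure (distr (K x) (borel \<Otimes>\<^sub>M borel) (Pair x)) (A \<times> B) = indicator A x * emeasure (K x) B"
      using A B by (subst emeasure_distr[OF m]) (auto simp: indicator_def vimage_def)
  qed
  finally show ?thesis .
qed

fun optimal_transport_kernel ::
    "(real \<Rightarrow> real \<Rightarrow> real) \<Rightarrow> (real \<Rightarrow> real) \<Rightarrow> (real \<Rightarrow> real) \<Rightarrow> transport_kernel \<Rightarrow> bool" where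
  "optimal_transport_kernel c cX cY (Markov_Kernel K) \<longleftrightarrow>
     K \<in> borel \<rightarrow>\<^sub>M prob_algebra borel \<and>
     (\<forall>\<mu>. fin_borel_measure \<mu> \<longrightarrow> transport_cost c \<mu> (\<mu> \<bind> K) < \<infinity> \<longrightarrow>
        optimal_coupling c \<mu> (\<mu> \<bind> K) (kernel_product \<mu> K))"
| "optimal_transport_kernel c cX cY (Coupling_Kernel \<gamma>) \<longleftrightarrow>
     (\<exists>\<mu> \<nu>. fin_borel_measure \<mu> \<and> fin_borel_measure \<nu> \<and>
        optimal_coupling c \<mu> \<nu> \<gamma> \<and> integrable \<mu> cX \<and> integrable \<nu> cY)"

text \<open>
  The density of a signed measure with respect to \<open>\<mu>\<close>, meaningful when \<open>total_variation a\<close> is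
  absolutely continuous with respect to \<open>\<mu>\<close>.
\<close>

definition signed_RN_deriv :: "real measure \<Rightarrow> (real set \<Rightarrow> real) \<Rightarrow> real \<Rightarrow> real" where
  "signed_RN_deriv \<mu> a x =
     enn2real (RN_deriv \<mu> (pos_part a) x) - enn2real (RN_deriv \<mu> (neg_part a) x)"

fun in_kernel_domain :: "(real \<Rightarrow> real) \<Rightarrow> transport_kernel \<Rightarrow> (real set \<Rightarrow> real) \<Rightarrow> bool" where
  "in_kernel_domain cX (Markov_Kernel K) a \<longleftrightarrow> signed_measure a"
| "in_kernel_domain cX (Coupling_Kernel \<gamma>) a \<longleftrightarrow>
     signed_measure a \<and>
     absolutely_continuous (distr \<gamma> borel fst) (total_variation a) \<and>
     (\<exists>M. AE x in distr \<gamma> borel fst. \<bar>signed_RN_deriv (distr \<gamma> borel fst) a x\<bar> \<le> M) \<and>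
     integrable (total_variation a) cX"

text \<open>
  For a coupling kernel, \<open>\<eta> K\<close> is the second marginal of the signed measure
  with density \<open>(x, y) \<mapsto> d\<eta>/d\<mu> (x)\<close> with respect to \<open>\<gamma>\<close>.
\<close>

fun kernel_image :: "(real set \<Rightarrow> real) \<Rightarrow> transport_kernel \<Rightarrow> real set \<Rightarrow> real" where
  "kernel_image a (Markov_Kernel K) B = signed_integral a (\<lambda>x. measure (K x) B)"
| "kernel_image a (Coupling_Kernel \<gamma>) B =
     (LINT z : snd -` B | \<gamma>. signed_RN_deriv (distr \<gamma> borel fst) a (fst z))"


section \<open>Strict convexity\<close>

definition strictly_convex :: "(real \<Rightarrow> real) \<Rightarrow> bool" where
  "strictly_convex h \<longleftrightarrow>
     (\<forall>x y t. x \<noteq> y \<longrightarrow> 0 < t \<longrightarrow> t < 1 \<longrightarrow>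
        h ((1 - t) * x + t * y) < (1 - t) * h x + t * h y)"

end

theory Submission
  imports Defs
begin

text \<open>
  Since \<open>a\<close> and \<open>b\<close> have the same total mass, a kernel sending \<open>a\<close> to \<open>b\<close> cannot cancel any mass:
  it sends \<open>a\<^sup>+\<close> to \<open>b\<^sup>+\<close> and \<open>a\<^sup>-\<close> to \<open>b\<^sup>-\<close>. An optimal coupling \<open>\<gamma>\<close> of finite cost is monotone:
  given two independent samples \<open>(x, y)\<close>, \<open>(x', y')\<close> of \<open>\<gamma>\<close> that cross, exchanging \<open>y\<close> and \<open>y'\<close>
  strictly lowers the cost by strict convexity, while averaging over the pairs of samples keeps both
  marginals; so crossings have \<open>\<gamma> \<otimes> \<gamma>\<close>-measure zero. For a monotone coupling the mass of
  \<open>(-\<infinity>, p] \<times> (-\<infinity>, q]\<close> is the minimum of the two distribution functions, hence a piece of \<open>a\<close> and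
  a piece of \<open>b\<close> exchange mass as soon as their ranges of cumulated mass overlap, and then they have
  the same sign. As the signs of consecutive pieces alternate, all cut points in cumulated mass
  agree, and so do the signatures.
\<close>

section \<open>Optimal couplings are monotone\<close>

lemma (in finite_measure) nn_integral_swap_self:
  assumes "f \<in> borel_measurable (M \<Otimes>\<^sub>M M)"
  shows "(\<integral>\<^sup>+u. f (snd u, fst u) \<partial>(M \<Otimes>\<^sub>M M)) = (\<integral>\<^sup>+u. f u \<partial>(M \<Otimes>\<^sub>M M))"
proof -
  interpret P: pair_sigma_finite M M by standard
  have "(\<integral>\<^sup>+u. f u \<partial>(M \<Otimes>\<^sub>M M)) = (\<integral>\<^sup>+u. f u \<partial>distr (M \<Otimes>\<^sub>M M) (M \<Otimes>\<^sub>M M) (\<lambda>(x, y). (y, x)))"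
    by (simp flip: P.distr_pair_swap)
  also have "\<dots> = (\<integral>\<^sup>+u. f (snd u, fst u) \<partial>(M \<Otimes>\<^sub>M M))"
    using assms by (subst nn_integral_distr) (auto simp: case_prod_beta measurable_pair_swap')
  finally show ?thesis by simp
qed

lemma (in finite_measure) nn_integral_fst_self:
  assumes "f \<in> borel_measurable M"
  shows "(\<integral>\<^sup>+u. f (fst u) \<partial>(M \<Otimes>\<^sub>M M)) = emeasure M (space M) * (\<integral>\<^sup>+z. f z \<partial>M)"
proof -
  have "(\<integral>\<^sup>+u. f (fst u) \<partial>(M \<Otimes>\<^sub>M M)) = (\<integral>\<^sup>+z. \<integral>\<^sup>+z'. f z \<partial>M \<partial>M)"
    using assms by (subst nn_integral_fst[symmetric]) auto
  then show ?thesis using assms by (simp add: nn_integral_multc mult.commute)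
qed

section \<open>Uncrossing pairs of independent samples\<close>

definition discordant :: "(real \<times> real) \<times> (real \<times> real) \<Rightarrow> bool" where
  "discordant u \<longleftrightarrow> (fst (fst u) < fst (snd u) \<and> snd (snd u) < snd (fst u)) \<or>
     (fst (snd u) < fst (fst u) \<and> snd (fst u) < snd (snd u))"

text \<open>Only the new pair that keeps the first sample's left coordinate is recorded. The other
  one is \<open>uncross\<close> of the swapped argument, so a single map into the plane suffices and
  symmetry of \<open>\<gamma> \<otimes> \<gamma>\<close> does the averaging.\<close>

definition uncross :: "(real \<times> real) \<times> (real \<times> real) \<Rightarrow> real \<times> real" where
  "uncross u = (fst (fst u), if discordant u then snd (snd u) else snd (fst u))"

lemma measurable_discordant [measurable]:
  "Measurable.pred ((borel \<Otimes>\<^sub>M borel) \<Otimes>\<^sub>M (borel \<Otimes>\<^sub>M borel)) discordant"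
  unfolding discordant_def by measurable

lemma measurable_uncross [measurable]:
  "uncross \<in> (borel \<Otimes>\<^sub>M borel) \<Otimes>\<^sub>M (borel \<Otimes>\<^sub>M borel) \<rightarrow>\<^sub>M borel \<Otimes>\<^sub>M borel"
  unfolding uncross_def by measurable

lemma discordant_swap: "discordant (snd u, fst u) \<longleftrightarrow> discordant u"
  by (auto simp: discordant_def)

text \<open>The product \<gamma> \<otimes> \<gamma> has the square of the mass of \<gamma>; the
  scaling restores the mass of \<gamma>, which makes this measure a competitor of \<gamma>.\<close>

definition uncrossed :: "(real \<times> real) measure \<Rightarrow> (real \<times> real) measure" where
  "uncrossed \<gamma> = scale_measure (inverse (emeasure \<gamma> (space \<gamma>)))
     (distr (\<gamma> \<Otimes>\<^sub>M \<gamma>) (borel \<Otimes>\<^sub>M borel) uncross)"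

lemma nn_integral_uncrossed:
  assumes s: "sets \<gamma> = sets (borel \<Otimes>\<^sub>M borel)" and f: "f \<in> borel_measurable (borel \<Otimes>\<^sub>M borel)"
  shows "(\<integral>\<^sup>+z. f z \<partial>uncrossed \<gamma>) =
    inverse (emeasure \<gamma> (space \<gamma>)) * (\<integral>\<^sup>+u. f (uncross u) \<partial>(\<gamma> \<Otimes>\<^sub>M \<gamma>))"
proof -
  note f[measurable]
  note [measurable_cong] = s
  show ?thesis unfolding uncrossed_def
    by (simp add: nn_integral_scale_measure nn_integral_distr)
qed

text \<open>The left coordinate is that of the first sample throughout. The right one comes from the
  second sample on the discordant event, but this event and \<gamma> \<otimes> \<gamma> are
  invariant under swapping the samples, so in law it may be read off the first sample there
  too.\<close>

lemma uncrossed_marginals: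
  assumes s: "sets \<gamma> = sets (borel \<Otimes>\<^sub>M borel)" and fin: "finite_measure \<gamma>"
    and T: "emeasure \<gamma> (space \<gamma>) \<noteq> 0"
  shows "distr (uncrossed \<gamma>) borel fst = distr \<gamma> borel fst"
    and "distr (uncrossed \<gamma>) borel snd = distr \<gamma> borel snd"
proof -
  interpret finite_measure \<gamma> by fact
  note [measurable_cong] = s
  have su: "sets (uncrossed \<gamma>) = sets (borel \<Otimes>\<^sub>M borel)" by (simp add: uncrossed_def)
  note [measurable_cong] = su
  \<comment> \<open>In \<open>ennreal\<close> the inverse of 0 is infinity and would not cancel;
    hence the assumption that \<gamma> has positive mass.\<close>
  have cancel: "inverse (emeasure \<gamma> (space \<gamma>)) * (emeasure \<gamma> (space \<gamma>) * x) = x" for x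
    using T emeasure_finite[of "space \<gamma>"]
    by (simp add: mult.assoc[symmetric] mult.commute[of "inverse _"] ennreal_divide_self less_top[symmetric] flip: divide_ennreal_def)
  have e: "emeasure (distr \<delta> borel g) A = (\<integral>\<^sup>+z. indicator A (g z) \<partial>\<delta>)"
    if d: "sets \<delta> = sets (borel \<Otimes>\<^sub>M borel)" and g: "g \<in> borel \<Otimes>\<^sub>M borel \<rightarrow>\<^sub>M borel" and A: "A \<in> sets borel"
    for \<delta> :: "(real \<times> real) measure" and g :: "real \<times> real \<Rightarrow> real" and A
  proof -
    note [measurable_cong] = d
    note g[measurable] A[measurable]
    have "emeasure (distr \<delta> borel g) A = (\<integral>\<^sup>+x. indicator A x \<partial>distr \<delta> borel g)" by simp
    also have "\<dots> = (\<integral>\<^sup>+z. indicator A (g z) \<partial>\<delta>)" by (rule nn_integral_distr) simp_all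
    finally show ?thesis .
  qed
  show "distr (uncrossed \<gamma>) borel fst = distr \<gamma> borel fst"
  proof (rule measure_eqI)
    fix A assume "A \<in> sets (distr (uncrossed \<gamma>) borel fst)"
    then have A[measurable]: "A \<in> sets borel" by simp
    have "emeasure (distr (uncrossed \<gamma>) borel fst) A =
        inverse (emeasure \<gamma> (space \<gamma>)) * (\<integral>\<^sup>+u. indicator A (fst (fst u)) \<partial>(\<gamma> \<Otimes>\<^sub>M \<gamma>))"
      by (simp add: e su nn_integral_uncrossed[OF s] uncross_def)
    also have "\<dots> = (\<integral>\<^sup>+z. indicator A (fst z) \<partial>\<gamma>)"
      by (subst nn_integral_fst_self[where f="\<lambda>z. indicator A (fst z)"]) (simp_all add: cancel)
    also have "\<dots> = emeasure (distr \<gamma> borel fst) A" by (simp add: e s)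
    finally show "emeasure (distr (uncrossed \<gamma>) borel fst) A = emeasure (distr \<gamma> borel fst) A" .
  qed simp
  show "distr (uncrossed \<gamma>) borel snd = distr \<gamma> borel snd"
  proof (rule measure_eqI)
    fix A assume "A \<in> sets (distr (uncrossed \<gamma>) borel snd)"
    then have A[measurable]: "A \<in> sets borel" by simp
    let ?D = "\<lambda>u. indicator {u. discordant u} u :: ennreal"
    let ?C = "\<lambda>u. indicator {u. \<not> discordant u} u :: ennreal"
    have "(\<integral>\<^sup>+u. indicator A (snd (uncross u)) \<partial>(\<gamma> \<Otimes>\<^sub>M \<gamma>)) =
        (\<integral>\<^sup>+u. ?D u * indicator A (snd (snd u)) + ?C u * indicator A (snd (fst u)) \<partial>(\<gamma> \<Otimes>\<^sub>M \<gamma>))"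
      by (intro nn_integral_cong) (simp add: uncross_def)
    also have "\<dots> = (\<integral>\<^sup>+u. ?D u * indicator A (snd (snd u)) \<partial>(\<gamma> \<Otimes>\<^sub>M \<gamma>)) +
        (\<integral>\<^sup>+u. ?C u * indicator A (snd (fst u)) \<partial>(\<gamma> \<Otimes>\<^sub>M \<gamma>))"
      by (rule nn_integral_add) measurable
    also have "(\<integral>\<^sup>+u. ?D u * indicator A (snd (snd u)) \<partial>(\<gamma> \<Otimes>\<^sub>M \<gamma>)) =
        (\<integral>\<^sup>+u. ?D u * indicator A (snd (fst u)) \<partial>(\<gamma> \<Otimes>\<^sub>M \<gamma>))"
      by (subst nn_integral_swap_self[symmetric]) (simp_all add: indicator_def discordant_swap)
    also have "\<dots> + (\<integral>\<^sup>+u. ?C u * indicator A (snd (fst u)) \<partial>(\<gamma> \<Otimes>\<^sub>M \<gamma>)) =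
        (\<integral>\<^sup>+u. ?D u * indicator A (snd (fst u)) + ?C u * indicator A (snd (fst u)) \<partial>(\<gamma> \<Otimes>\<^sub>M \<gamma>))"
      by (rule nn_integral_add[symmetric]) measurable
    also have "\<dots> = (\<integral>\<^sup>+u. indicator A (snd (fst u)) \<partial>(\<gamma> \<Otimes>\<^sub>M \<gamma>))"
      by (intro nn_integral_cong) (simp add: indicator_def)
    finally have *: "(\<integral>\<^sup>+u. indicator A (snd (uncross u)) \<partial>(\<gamma> \<Otimes>\<^sub>M \<gamma>)) =
        (\<integral>\<^sup>+u. indicator A (snd (fst u)) \<partial>(\<gamma> \<Otimes>\<^sub>M \<gamma>) :: ennreal)" .
    have "emeasure (distr (uncrossed \<gamma>) borel snd) A =
        inverse (emeasure \<gamma> (space \<gamma>)) * (\<integral>\<^sup>+u. indicator A (snd (fst u)) \<partial>(\<gamma> \<Otimes>\<^sub>M \<gamma>))"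
      by (simp add: e su nn_integral_uncrossed[OF s] *)
    also have "\<dots> = (\<integral>\<^sup>+z. indicator A (snd z) \<partial>\<gamma>)"
      by (subst nn_integral_fst_self[where f="\<lambda>z. indicator A (snd z)"]) (simp_all add: cancel)
    also have "\<dots> = emeasure (distr \<gamma> borel snd) A" by (simp add: e s)
    finally show "emeasure (distr (uncrossed \<gamma>) borel snd) A = emeasure (distr \<gamma> borel snd) A" .
  qed simp
qed

text \<open>Integrated over \<gamma> \<otimes> \<gamma>, the costs of the two old pairs and of the
  two new pairs are, by symmetry, twice the mass of \<gamma> times the costs of \<gamma> and of
  \<open>uncrossed \<gamma>\<close>. A non-null set of crossings would therefore make
  \<open>uncrossed \<gamma>\<close> strictly cheaper.\<close>

lemma optimal_coupling_AE_concordant: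
  fixes c :: "real \<Rightarrow> real \<Rightarrow> real"
  assumes c: "(\<lambda>z. c (fst z) (snd z)) \<in> borel_measurable (borel \<Otimes>\<^sub>M borel)"
    and nonneg: "\<And>x y. 0 \<le> c x y"
    and monge: "\<And>x x' y y'. x < x' \<Longrightarrow> y' < y \<Longrightarrow> c x y' + c x' y < c x y + c x' y'"
    and opt: "optimal_coupling c \<mu> \<nu> \<gamma>" and fin: "finite_measure \<gamma>"
    and cost: "coupling_cost c \<gamma> < \<infinity>"
  shows "AE u in \<gamma> \<Otimes>\<^sub>M \<gamma>. \<not> discordant u"
proof (rule ccontr)
  assume neg: "\<not> ?thesis"
  interpret finite_measure \<gamma> by fact
  have s: "sets \<gamma> = sets (borel \<Otimes>\<^sub>M borel)"
    and marg: "distr \<gamma> borel fst = \<mu>" "distr \<gamma> borel snd = \<nu>"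
    using opt by (auto simp: optimal_coupling_def is_coupling_def)
  note [measurable_cong] = s
  note c[measurable]
  define C where "C z = ennreal (c (fst z) (snd z))" for z
  have C[measurable]: "C \<in> borel_measurable (borel \<Otimes>\<^sub>M borel)" unfolding C_def by measurable
  let ?P = "\<gamma> \<Otimes>\<^sub>M \<gamma>" and ?T = "emeasure \<gamma> (space \<gamma>)"
  have T: "?T \<noteq> 0"
  proof
    assume "?T = 0"
    then have "emeasure ?P (space ?P) = 0"
      by (simp add: space_pair_measure emeasure_pair_measure_Times)
    then have "AE u in ?P. \<not> discordant u"
      by (intro AE_I[of _ _ "space ?P"]) auto
    with neg show False by simp
  qed
  have cpl: "is_coupling \<mu> \<nu> (uncrossed \<gamma>)"
    using uncrossed_marginals[OF s fin T] marg by (simp add: is_coupling_def uncrossed_def)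
  have le: "(\<integral>\<^sup>+z. C z \<partial>\<gamma>) \<le> inverse ?T * (\<integral>\<^sup>+u. C (uncross u) \<partial>?P)"
  proof -
    have "coupling_cost c \<gamma> \<le> coupling_cost c (uncrossed \<gamma>)"
      using opt cpl by (simp add: optimal_coupling_def)
    also have "\<dots> = inverse ?T * (\<integral>\<^sup>+u. C (uncross u) \<partial>?P)"
      unfolding coupling_cost_def by (simp add: nn_integral_uncrossed[OF s] C_def)
    finally show ?thesis by (simp add: coupling_cost_def C_def)
  qed
  have fin': "(\<integral>\<^sup>+z. C z \<partial>\<gamma>) < \<infinity>" using cost by (simp add: coupling_cost_def C_def)
  have int: "(\<integral>\<^sup>+u. C (fst u) \<partial>?P) = ?T * (\<integral>\<^sup>+z. C z \<partial>\<gamma>)"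
    by (rule nn_integral_fst_self) simp
  \<comment> \<open>On a discordant \<open>u\<close> the two new points are \<open>(x, y')\<close>
    and \<open>(x', y)\<close>, so this is the strict exchange inequality \<open>monge\<close>;
    elsewhere nothing moves and equality holds.\<close>
  have pt: "C (uncross u) + C (uncross (snd u, fst u)) \<le> C (fst u) + C (snd u)"
    "discordant u \<Longrightarrow> C (uncross u) + C (uncross (snd u, fst u)) < C (fst u) + C (snd u)" for u
  proof -
    show *: "C (uncross u) + C (uncross (snd u, fst u)) < C (fst u) + C (snd u)" if "discordant u"
      using that monge[of "fst (fst u)" "fst (snd u)" "snd (snd u)" "snd (fst u)"]
        monge[of "fst (snd u)" "fst (fst u)" "snd (fst u)" "snd (snd u)"] nonneg
      by (auto simp: C_def uncross_def discordant_swap discordant_def ennreal_plus[symmetric] ennreal_less_iff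
            simp del: ennreal_plus)
    show "C (uncross u) + C (uncross (snd u, fst u)) \<le> C (fst u) + C (snd u)"
      using * by (cases "discordant u") (auto simp: uncross_def discordant_swap)
  qed
  have swap: "(\<integral>\<^sup>+u. C (uncross (snd u, fst u)) \<partial>?P) = (\<integral>\<^sup>+u. C (uncross u) \<partial>?P)"
    "(\<integral>\<^sup>+u. C (snd u) \<partial>?P) = (\<integral>\<^sup>+u. C (fst u) \<partial>?P)"
    by (rule nn_integral_swap_self, simp)
       (subst nn_integral_swap_self[symmetric], simp_all)
  have "(\<integral>\<^sup>+u. C (uncross u) + C (uncross (snd u, fst u)) \<partial>?P) <
      (\<integral>\<^sup>+u. C (fst u) + C (snd u) \<partial>?P)" (is "?L < ?R")
  proof (rule nn_integral_less)
    \<comment> \<open>This is where finite cost enters: a pointwise strict inequality on a non-null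
      set gives strictly smaller integrals only if the smaller integral is finite.\<close>
    have "?R < \<infinity>"
      using fin' emeasure_finite[of "space \<gamma>"]
      by (simp add: nn_integral_add swap int ennreal_mult_eq_top_iff less_top[symmetric])
    moreover have "?L \<le> ?R" by (intro nn_integral_mono pt)
    ultimately show "?L \<noteq> \<infinity>" by auto
    show "AE u in ?P. C (uncross u) + C (uncross (snd u, fst u)) \<le> C (fst u) + C (snd u)"
      by (simp add: pt)
    show "\<not> (AE u in ?P. C (fst u) + C (snd u) \<le> C (uncross u) + C (uncross (snd u, fst u)))"
    proof
      assume "AE u in ?P. C (fst u) + C (snd u) \<le> C (uncross u) + C (uncross (snd u, fst u))"
      then have "AE u in ?P. \<not> discordant u" by eventually_elim (use pt in \<open>auto simp: not_less[symmetric]\<close>)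
      with neg show False by simp
    qed
  qed measurable
  \<comment> \<open>Each side is a sum of two equal terms. The halving is by contraposition: the
    reverse inequality between the terms could be added to itself.\<close>
  then have "(\<integral>\<^sup>+u. C (uncross u) \<partial>?P) < ?T * (\<integral>\<^sup>+z. C z \<partial>\<gamma>)"
    by (simp add: nn_integral_add swap int) (meson add_mono leD leI)
  moreover have "?T * (\<integral>\<^sup>+z. C z \<partial>\<gamma>) \<le> ?T * (inverse ?T * (\<integral>\<^sup>+u. C (uncross u) \<partial>?P))"
    using le by (rule mult_left_mono) simp
  moreover have "?T * (inverse ?T * x) = x" for x
    using T emeasure_finite[of "space \<gamma>"] by (simp add: mult.assoc[symmetric] ennreal_divide_self less_top[symmetric] flip: divide_ennreal_def)
  ultimately show False by simp
qed

section \<open>Jordan decompositions\<close>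

lemma signed_measure_parts:
  assumes a: "signed_measure a"
  shows "finite_measure (pos_part a)" "finite_measure (neg_part a)"
    and "sets (pos_part a) = sets borel" "sets (neg_part a) = sets borel"
    and "space (pos_part a) = UNIV" "space (neg_part a) = UNIV"
    and "finite_measure (total_variation a)"
    and "B \<in> sets borel \<Longrightarrow> measure (total_variation a) B = measure (pos_part a) B + measure (neg_part a) B"
    and "B \<in> sets borel \<Longrightarrow> a B = measure (pos_part a) B - measure (neg_part a) B"
proof -
  show P: "finite_measure (pos_part a)" and N: "finite_measure (neg_part a)"
    and s: "sets (pos_part a) = sets borel" "sets (neg_part a) = sets borel"
    and "B \<in> sets borel \<Longrightarrow> a B = measure (pos_part a) B - measure (neg_part a) B"
    using jordan_decomposition_parts[OF a]
    by (auto simp: jordan_decomposition_def fin_borel_measure_def)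
  show sp: "space (pos_part a) = UNIV" "space (neg_part a) = UNIV"
    using s[THEN sets_eq_imp_space_eq] by auto
  interpret P: finite_measure "pos_part a" by fact
  interpret N: finite_measure "neg_part a" by fact
  have e: "emeasure (total_variation a) B = ennreal (measure (pos_part a) B + measure (neg_part a) B)"
    if "B \<in> sets borel" for B
    using emeasure_total_variation[OF a that] by (simp add: P.emeasure_eq_measure N.emeasure_eq_measure)
  show "finite_measure (total_variation a)"
    using sets_eq_imp_space_eq[OF sets_total_variation[of a]] by (intro finite_measureI) (simp add: e)
  show "B \<in> sets borel \<Longrightarrow> measure (total_variation a) B = measure (pos_part a) B + measure (neg_part a) B"
    by (simp add: e measure_def[of "total_variation a"] del: ennreal_plus)
qed

text \<open>\<open>total_variation\<close> is given by its values on sets, so additivity is extended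
  from indicators to non-negative functions. It is used to split what a Markov kernel makes of |a|
  into the contributions of the two Jordan parts.\<close>

lemma nn_integral_total_variation:
  assumes a: "signed_measure a" and f: "f \<in> borel_measurable borel"
  shows "(\<integral>\<^sup>+x. f x \<partial>total_variation a) = (\<integral>\<^sup>+x. f x \<partial>pos_part a) + (\<integral>\<^sup>+x. f x \<partial>neg_part a)"
proof -
  note s = signed_measure_parts(3,4)[OF a]
  have meas: "g \<in> borel_measurable (total_variation a)" "g \<in> borel_measurable (pos_part a)"
    "g \<in> borel_measurable (neg_part a)" if "g \<in> borel_measurable borel" for g :: "real \<Rightarrow> ennreal"
    using that s by (simp_all cong: measurable_cong_sets)
  show ?thesis using f
  proof (induction rule: borel_measurable_induct)
    case (cong f g)
    then show ?case by simp
  next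
    case (set A)
    then show ?case using s by (simp add: emeasure_total_variation[OF a])
  next
    case (mult u c)
    then show ?case by (simp add: meas nn_integral_cmult distrib_left)
  next
    case (add u v)
    then show ?case by (simp add: meas nn_integral_add ac_simps)
  next
    case (seq U)
    have I: "incseq (\<lambda>i. integral\<^sup>N M (U i))" for M :: "real measure"
      using seq by (auto simp: incseq_def le_fun_def intro!: nn_integral_mono)
    have "(\<integral>\<^sup>+x. (SUP i. U i x) \<partial>total_variation a) = (SUP i. \<integral>\<^sup>+x. U i x \<partial>total_variation a)"
      using seq by (intro nn_integral_monotone_convergence_SUP) (auto simp: meas)
    also have "\<dots> = (SUP i. (\<integral>\<^sup>+x. U i x \<partial>pos_part a)) + (SUP i. \<integral>\<^sup>+x. U i x \<partial>neg_part a)"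
      using seq by (simp add: ennreal_SUP_add[OF I I])
    also have "\<dots> = (\<integral>\<^sup>+x. (SUP i. U i x) \<partial>pos_part a) + (\<integral>\<^sup>+x. (SUP i. U i x) \<partial>neg_part a)"
      using seq by (simp add: nn_integral_monotone_convergence_SUP meas)
    finally show ?case by (simp add: image_comp)
  qed
qed

text \<open>This is the absence of cancellation: a representation of \<open>b\<close> as a
  difference \<open>P - N\<close> exceeds the Jordan decomposition by the same measure in both
  terms, and the excess is zero when the total masses agree.\<close>

lemma jordan_decomposition_of_mass_eq:
  assumes b: "signed_measure b" and P: "fin_borel_measure P" and N: "fin_borel_measure N"
    and diff: "\<And>B. B \<in> sets borel \<Longrightarrow> b B = measure P B - measure N B"
    and mass: "measure P UNIV + measure N UNIV = measure (total_variation b) UNIV"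
  shows "pos_part b = P" "neg_part b = N"
proof -
  note tv = signed_measure_parts[OF b]
  have borel_UNIV: "UNIV \<in> sets (borel :: real measure)" by simp
  interpret P: finite_measure P using P by (simp add: fin_borel_measure_def)
  interpret N: finite_measure N using N by (simp add: fin_borel_measure_def)
  interpret bP: finite_measure "pos_part b" by (rule tv)
  interpret bN: finite_measure "neg_part b" by (rule tv)
  have s[simp]: "sets P = sets borel" "sets N = sets borel"
    using P N by (auto simp: fin_borel_measure_def)
  obtain A where A: "A \<in> sets borel" "emeasure (pos_part b) (- A) = 0" "emeasure (neg_part b) A = 0"
    using jordan_decomposition_parts[OF b] unfolding jordan_decomposition_def by blast
  have cA: "- A \<in> sets borel" using A(1) by (rule borel_comp)
  have split: "measure M UNIV = measure M A + measure M (- A)"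
    if "finite_measure M" "sets M = sets borel" for M
    using finite_measure.finite_measure_Union[OF that(1), of A "- A"] that A(1) cA by simp
  have A0: "measure (pos_part b) (- A) = 0" "measure (neg_part b) A = 0"
    using A(2,3) by (simp_all add: bP.emeasure_eq_measure bN.emeasure_eq_measure)
  \<comment> \<open>Here \<open>A\<close> is a Hahn set of \<open>b\<close>. Adding
    \<open>b A = P A - N A\<close> and the negative of the same identity on \<open>- A\<close> shows
    that the masses of \<open>P\<close> and \<open>N\<close> together exceed that of |b| by
    \<open>2 * (N A + P (- A))\<close>.\<close>
  have "measure N A = 0 \<and> measure P (- A) = 0"
    using mass tv(8)[OF borel_UNIV] tv(9)[OF A(1)] tv(9)[OF cA] diff[OF A(1)] diff[OF cA]
      split[OF tv(1,3)] split[OF tv(2,4)] split[OF P.finite_measure_axioms s(1)]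
      split[OF N.finite_measure_axioms s(2)] A0
      measure_nonneg[of N A] measure_nonneg[of P "- A"]
    by linarith
  then have "jordan_decomposition b P N"
    unfolding jordan_decomposition_def using P N A(1) diff
    by (auto simp: P.emeasure_eq_measure N.emeasure_eq_measure intro!: bexI[of _ A])
  then show "pos_part b = P" "neg_part b = N"
    using jordan_decomposition_unique[OF jordan_decomposition_parts[OF b]] by blast+
qed

section \<open>Signatures\<close>

text \<open>The partial sums cut an interval of mass in two ways, and by the last assumption cells
  that overlap in positive length have entries of the same sign. If the first cell of one list were
  shorter, its second cell would also meet the first cell of the other list, so the first two
  entries would have the same sign, against alternation. Hence the heads agree, and induction
  handles the tails.\<close>

lemma alternating_lists_eq:
  fixes z w :: "real list"
  assumes "successively (\<lambda>x y. x * y < 0) z" "successively (\<lambda>x y. x * y < 0) w"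
    and "0 \<notin> set z" "0 \<notin> set w"
    and "(\<Sum>k<length z. \<bar>z ! k\<bar>) = (\<Sum>k<length w. \<bar>w ! k\<bar>)"
    and "\<And>i j. i < length z \<Longrightarrow> j < length w \<Longrightarrow>
      max (\<Sum>k<i. \<bar>z ! k\<bar>) (\<Sum>k<j. \<bar>w ! k\<bar>) < min (\<Sum>k<Suc i. \<bar>z ! k\<bar>) (\<Sum>k<Suc j. \<bar>w ! k\<bar>) \<Longrightarrow>
      0 < z ! i * w ! j"
  shows "z = w"
  using assms
proof (induction z arbitrary: w)
  case Nil
  show ?case
  proof (cases w)
    case (Cons y w')
    have "\<bar>w ! 0\<bar> \<le> (\<Sum>k<length w. \<bar>w ! k\<bar>)" by (rule member_le_sum) (simp_all add: Cons)
    then show ?thesis using Nil Cons by simp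
  qed simp
next
  case (Cons x z')
  have shift: "(\<Sum>k<Suc n. \<bar>(u # v) ! k\<bar>) = \<bar>u\<bar> + (\<Sum>k<n. \<bar>v ! k\<bar>)" for n and u :: real and v
    by (subst sum.lessThan_Suc_shift) simp
  have len: "(\<Sum>k<length (u # v). \<bar>(u # v) ! k\<bar>) = \<bar>u\<bar> + (\<Sum>k<length v. \<bar>v ! k\<bar>)" for u :: real and v
    by (simp only: list.size(4) add_0_right add_Suc_right shift)
  have nn: "0 \<le> (\<Sum>k<n. \<bar>v ! k\<bar>)" for n and v :: "real list" by (rule sum_nonneg) simp
  have x: "x \<noteq> 0" using Cons.prems by auto
  show ?case
  proof (cases w)
    case Nil
    then have "\<bar>x\<bar> + (\<Sum>k<length z'. \<bar>z' ! k\<bar>) = 0" using Cons.prems(5) unfolding len by simp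
    then have False using x nn[of z' "length z'"] by linarith
    then show ?thesis ..
  next
    case (Cons y w')
    note w = this
    have y: "y \<noteq> 0" using Cons.prems w by auto
    note overlap = Cons.prems(6)
    have tot: "\<bar>x\<bar> + (\<Sum>k<length z'. \<bar>z' ! k\<bar>) = \<bar>y\<bar> + (\<Sum>k<length w'. \<bar>w' ! k\<bar>)"
      using Cons.prems(5) unfolding w len .
    have xy: "0 < x * y" using overlap[of 0 0] x y by (simp add: w)
    have "\<not> \<bar>x\<bar> < \<bar>y\<bar>"
    proof
      assume lt: "\<bar>x\<bar> < \<bar>y\<bar>"
      \<comment> \<open>Equal totals guarantee that the list with the shorter first cell has a
        second entry.\<close>
      then have "(\<Sum>k<length z'. \<bar>z' ! k\<bar>) \<noteq> 0" using tot nn[of w' "length w'"] by linarith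
      then have "z' \<noteq> []" by auto
      then obtain x2 z2 where z': "z' = x2 # z2" by (cases z') auto
      then have "x2 \<noteq> 0" "x * x2 < 0" using Cons.prems by auto
      moreover have "0 < x2 * y" using overlap[of 1 0] lt x \<open>x2 \<noteq> 0\<close> by (simp add: w z' numeral_2_eq_2)
      ultimately show False using xy
        by (smt (verit) zero_less_mult_iff mult_less_0_iff)
    qed
    moreover have "\<not> \<bar>y\<bar> < \<bar>x\<bar>"
    proof
      assume lt: "\<bar>y\<bar> < \<bar>x\<bar>"
      then have "(\<Sum>k<length w'. \<bar>w' ! k\<bar>) \<noteq> 0" using tot nn[of z' "length z'"] by linarith
      then have "w' \<noteq> []" by auto
      then obtain y2 w2 where w': "w' = y2 # w2" by (cases w') auto
      then have "y2 \<noteq> 0" "y * y2 < 0" using Cons.prems w by auto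
      moreover have "0 < x * y2" using overlap[of 0 1] lt y \<open>y2 \<noteq> 0\<close> by (simp add: w w' numeral_2_eq_2)
      ultimately show False using xy
        by (smt (verit) zero_less_mult_iff mult_less_0_iff)
    qed
    ultimately have "\<bar>x\<bar> = \<bar>y\<bar>" by simp
    then have eq: "x = y" using xy by (smt (verit) zero_less_mult_iff)
    have "z' = w'"
    proof (rule Cons.IH)
      show "successively (\<lambda>x y. x * y < 0) z'" "successively (\<lambda>x y. x * y < 0) w'"
        using Cons.prems(1,2) w by (auto simp: successively_Cons)
      show "0 \<notin> set z'" "0 \<notin> set w'" using Cons.prems(3,4) w by auto
      show "(\<Sum>k<length z'. \<bar>z' ! k\<bar>) = (\<Sum>k<length w'. \<bar>w' ! k\<bar>)" using tot eq by simp
      \<comment> \<open>Putting the common head back shifts all four partial sums by the same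
        amount, so the overlap condition is unchanged.\<close>
      fix i j assume "i < length z'" "j < length w'"
        and "max (\<Sum>k<i. \<bar>z' ! k\<bar>) (\<Sum>k<j. \<bar>w' ! k\<bar>) < min (\<Sum>k<Suc i. \<bar>z' ! k\<bar>) (\<Sum>k<Suc j. \<bar>w' ! k\<bar>)"
      then show "0 < z' ! i * w' ! j"
        using overlap[of "Suc i" "Suc j"] unfolding w shift eq by simp
    qed
    then show ?thesis using eq w by simp
  qed
qed

lemma ereal_Ioc_borel [measurable]: "ereal_Ioc s t \<in> sets borel"
  unfolding ereal_Ioc_def by measurable

text \<open>A zero entry cannot have a neighbour, since a product with 0 is not negative. The list
  \<open>[0]\<close> is the signature of a single piece of net mass 0.\<close>

lemma successively_sign_change_zero:
  fixes z :: "'a::linordered_idom list"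
  assumes "successively (\<lambda>x y. x * y < 0) z" "0 \<in> set z"
  shows "z = [0]"
  using assms
  by (induction "\<lambda>x y :: 'a. x * y < 0" z rule: successively.induct) auto

text \<open>Strict positivity only provides some Borel set with nonzero value. Each of
  \<open>d\<close> and \<open>e\<close> is, up to sign, the restriction of a measure to its cell, so
  its value on the whole cell is at least as large in modulus and thus nonzero.\<close>

lemma opposite_sign_mult_neg:
  assumes "opposite_sign d e"
    and "(\<forall>B\<in>sets borel. d B = measure M (B \<inter> A)) \<or> (\<forall>B\<in>sets borel. d B = - measure N (B \<inter> A))"
    and "(\<forall>B\<in>sets borel. e B = measure M (B \<inter> A')) \<or> (\<forall>B\<in>sets borel. e B = - measure N (B \<inter> A'))"
    and "finite_measure M" "finite_measure N" "sets M = sets borel" "sets N = sets borel"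
    and A: "A \<in> sets borel" "A' \<in> sets borel"
  shows "d A * e A' < 0"
proof -
  have nz: "0 < \<sigma> * f C"
    if f: "(\<forall>B\<in>sets borel. f B = measure M (B \<inter> C)) \<or> (\<forall>B\<in>sets borel. f B = - measure N (B \<inter> C))"
      and C: "C \<in> sets borel" and pos: "strictly_positive (\<lambda>B. \<sigma> * f B)" and \<sigma>: "\<bar>\<sigma>\<bar> = 1"
    for f :: "real set \<Rightarrow> real" and C and \<sigma> :: real
  proof -
    obtain B where B: "B \<in> sets borel" "f B \<noteq> 0"
      using pos by (auto simp: strictly_positive_def)
    have "0 \<le> \<sigma> * f C" using pos C by (simp add: strictly_positive_def)
    moreover have "\<bar>f B\<bar> \<le> \<bar>f C\<bar>"
    proof -
      have "measure M (B \<inter> C) \<le> measure M C" "measure N (B \<inter> C) \<le> measure N C"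
        using assms(4-7) C by (auto intro!: finite_measure.finite_measure_mono)
      then show ?thesis using f B(1) C by fastforce
    qed
    ultimately show ?thesis using B(2) \<sigma> by (auto simp: order_less_le)
  qed
  have pos: "strictly_positive d \<Longrightarrow> 0 < d A" "strictly_positive (\<lambda>B. - d B) \<Longrightarrow> d A < 0"
    "strictly_positive e \<Longrightarrow> 0 < e A'" "strictly_positive (\<lambda>B. - e B) \<Longrightarrow> e A' < 0"
    using nz[OF assms(2) A(1), of 1] nz[OF assms(2) A(1), of "-1"]
      nz[OF assms(3) A(2), of 1] nz[OF assms(3) A(2), of "-1"] by simp_all
  show ?thesis
    using assms(1) pos unfolding opposite_sign_def by (auto simp: mult_less_0_iff)
qed

text \<open>Extracts from a signature what the comparison uses: strictly alternating entries and
  cells on each of which one Jordan part has no mass.\<close>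

lemma has_signature_pieces:
  assumes a: "signed_measure a" and sig: "has_signature a z"
  shows "z \<noteq> []" "successively (\<lambda>x y. x * y < 0) z"
    and "\<exists>p. p 0 = -\<infinity> \<and> p (length z) = \<infinity> \<and> (\<forall>i<length z. p i < p (Suc i)) \<and>
      (\<forall>i<length z. z ! i = a (ereal_Ioc (p i) (p (Suc i)))) \<and>
      (\<forall>i<length z. measure (pos_part a) (ereal_Ioc (p i) (p (Suc i))) = 0 \<or>
        measure (neg_part a) (ereal_Ioc (p i) (p (Suc i))) = 0)"
proof -
  obtain n p d where n: "1 \<le> n" and p: "p 0 = -\<infinity>" "p n = \<infinity>" "\<forall>i<n. p i < p (Suc i)"
    and sum: "\<forall>B\<in>sets borel. a B = (\<Sum>i<n. d i B)"
    and "\<forall>i<n. \<forall>j<n. i \<noteq> j \<longrightarrow> signed_mutually_singular (d i) (d j)"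
    and van: "\<forall>i<n. vanishes_on (d i) (- ereal_Ioc (p i) (p (Suc i)))"
    and piece: "\<forall>i<n.
          (\<forall>B\<in>sets borel. d i B = measure (pos_part a) (B \<inter> ereal_Ioc (p i) (p (Suc i)))) \<or>
          (\<forall>B\<in>sets borel. d i B = - measure (neg_part a) (B \<inter> ereal_Ioc (p i) (p (Suc i))))"
    and opp: "\<forall>i. Suc i < n \<longrightarrow> opposite_sign (d i) (d (Suc i))"
    and z: "z = map (\<lambda>i. a (ereal_Ioc (p i) (p (Suc i)))) [0..<n]"
    using sig unfolding has_signature_def by (elim exE conjE) (rule that)
  note tv = signed_measure_parts[OF a]
  let ?A = "\<lambda>i. ereal_Ioc (p i) (p (Suc i))"
  have mono: "p i \<le> p j" if "i \<le> j" "j \<le> n" for i j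
    using that by (induction rule: dec_induct) (use p(3) in \<open>force intro: order.trans[OF _ less_imp_le]\<close>)+
  have disj: "?A i \<subseteq> - ?A j" if "i < n" "j < n" "i \<noteq> j" for i j
  proof (cases "i < j")
    case True
    then have "p (Suc i) \<le> p j" using that by (intro mono) auto
    then show ?thesis by (auto simp: ereal_Ioc_def)
  next
    case False
    then have "p (Suc j) \<le> p i" using that by (intro mono) auto
    then show ?thesis by (auto simp: ereal_Ioc_def)
  qed
  have aA: "a (?A i) = d i (?A i)" if i: "i < n" for i
  proof -
    have "d j (?A i) = 0" if "j < n" "j \<noteq> i" for j
      using van[rule_format, OF that(1)] disj[OF i that(1)] that(2) by (auto simp: vanishes_on_def)
    then have "(\<Sum>j<n. d j (?A i)) = (\<Sum>j\<in>{i}. d j (?A i))"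
      using i by (intro sum.mono_neutral_right) auto
    then show ?thesis by (simp add: sum)
  qed
  have "p 0 = -\<infinity>" "p (length z) = \<infinity>" using p z by auto
  moreover have "\<forall>i<length z. p i < p (Suc i)" "\<forall>i<length z. z ! i = a (?A i)"
    using p(3) z by auto
  \<comment> \<open>The other pieces vanish on cell \<open>i\<close>, so \<open>a\<close> agrees
    there with one signed Jordan part; as it is also the difference of both parts, the other part
    has mass 0 on the cell.\<close>
  moreover have "\<forall>i<length z. measure (pos_part a) (?A i) = 0 \<or> measure (neg_part a) (?A i) = 0"
  proof (intro allI impI)
    fix i assume "i < length z"
    then show "measure (pos_part a) (?A i) = 0 \<or> measure (neg_part a) (?A i) = 0"
      using piece[rule_format, of i] aA[of i] tv(9)[of "?A i"] z by auto
  qed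
  ultimately show "\<exists>p. p 0 = -\<infinity> \<and> p (length z) = \<infinity> \<and> (\<forall>i<length z. p i < p (Suc i)) \<and>
      (\<forall>i<length z. z ! i = a (ereal_Ioc (p i) (p (Suc i)))) \<and>
      (\<forall>i<length z. measure (pos_part a) (ereal_Ioc (p i) (p (Suc i))) = 0 \<or>
        measure (neg_part a) (ereal_Ioc (p i) (p (Suc i))) = 0)"
    by (intro exI[of _ p] conjI)
  show "z \<noteq> []" using n z by auto
  show "successively (\<lambda>x y. x * y < 0) z"
    unfolding successively_conv_nth
  proof (intro allI impI)
    fix i assume "Suc i < length z"
    then have i: "Suc i < n" using z by simp
    have "d i (?A i) * d (Suc i) (?A (Suc i)) < 0"
      by (rule opposite_sign_mult_neg[OF opp[rule_format, OF i] piece[rule_format] piece[rule_format]])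
         (use i tv in auto)
    then show "z ! i * z ! Suc i < 0" using i aA[of i] aA[of "Suc i"] by (simp add: z)
  qed
qed

section \<open>Monotone couplings match signatures\<close>

lemma finite_measure_distrD:
  assumes f: "f \<in> M \<rightarrow>\<^sub>M N" and fin: "finite_measure (distr M N f)"
  shows "finite_measure M"
proof (rule finite_measureI)
  have "f -` space N \<inter> space M = space M" using measurable_space[OF f] by auto
  then have "emeasure (distr M N f) (space N) = emeasure M (space M)" using f by (simp add: emeasure_distr)
  then show "emeasure M (space M) \<noteq> \<infinity>" using finite_measure.emeasure_finite[OF fin, of "space N"] by simp
qed

text \<open>The extended endpoint lets the outermost cut points give the empty set and the whole
  line.\<close>

abbreviation ereal_Iic :: "ereal \<Rightarrow> real set" where
  "ereal_Iic t \<equiv> {x. ereal x \<le> t}"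

text \<open>Only one Jordan part charges each cell, so the modulus of an entry is the |a|-mass of
  its cell, and the sums telescope to the distribution function of |a| at the cut points.\<close>

lemma signature_partial_sums:
  assumes a: "signed_measure a"
    and p: "p 0 = -\<infinity>" "\<And>i. i < n \<Longrightarrow> p i < p (Suc i)"
    and z: "\<And>i. i < n \<Longrightarrow> z ! i = a (ereal_Ioc (p i) (p (Suc i)))"
    and pure: "\<And>i. i < n \<Longrightarrow> measure (pos_part a) (ereal_Ioc (p i) (p (Suc i))) = 0 \<or>
      measure (neg_part a) (ereal_Ioc (p i) (p (Suc i))) = 0"
    and k: "k \<le> n"
  shows "(\<Sum>i<k. \<bar>z ! i\<bar>) = measure (total_variation a) (ereal_Iic (p k))"
  using k
proof (induction k)
  case 0
  have "ereal_Iic (p 0) = {}" by (simp add: p)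
  then show ?case by (simp only: lessThan_0 sum.empty measure_empty)
next
  case (Suc k)
  note tv = signed_measure_parts[OF a]
  have "ereal_Iic (p (Suc k)) = ereal_Iic (p k) \<union> ereal_Ioc (p k) (p (Suc k))"
    using p(2)[of k] Suc.prems by (auto simp: ereal_Ioc_def)
  moreover have "ereal_Iic (p k) \<inter> ereal_Ioc (p k) (p (Suc k)) = {}" by (auto simp: ereal_Ioc_def)
  ultimately have "measure (total_variation a) (ereal_Iic (p (Suc k))) =
      measure (total_variation a) (ereal_Iic (p k)) + measure (total_variation a) (ereal_Ioc (p k) (p (Suc k)))"
    using finite_measure.finite_measure_Union[OF tv(7)] by (simp add: ereal_Ioc_borel)
  moreover have "\<bar>z ! k\<bar> = measure (total_variation a) (ereal_Ioc (p k) (p (Suc k)))"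
    using z[of k] pure[of k] Suc.prems tv(8,9)[OF ereal_Ioc_borel, of "p k" "p (Suc k)"] by auto
  ultimately show ?case using Suc by simp
qed

text \<open>Common end of the argument for both kinds of kernels. Monotonicity is asked of the sum
  of the two couplings, which couples |a| with |b|, while each summand only joins parts of equal
  sign. Monotonicity thus detects which cells exchange mass, and the summands show that those cells
  have the same sign.\<close>

lemma signatures_eq_of_monotone_coupling:
  assumes a: "signed_measure a" and b: "signed_measure b"
    and za: "has_signature a z" and wb: "has_signature b w"
    and sP: "sets \<gamma>P = sets (borel \<Otimes>\<^sub>M borel)" and sN: "sets \<gamma>N = sets (borel \<Otimes>\<^sub>M borel)"
    and fst: "distr \<gamma>P borel fst = pos_part a" "distr \<gamma>N borel fst = neg_part a"
    and snd: "distr \<gamma>P borel snd = pos_part b" "distr \<gamma>N borel snd = neg_part b"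
    and mono: "\<And>p q. measure \<gamma>P (ereal_Iic p \<times> (- ereal_Iic q)) + measure \<gamma>N (ereal_Iic p \<times> (- ereal_Iic q)) = 0 \<or>
      measure \<gamma>P ((- ereal_Iic p) \<times> ereal_Iic q) + measure \<gamma>N ((- ereal_Iic p) \<times> ereal_Iic q) = 0"
  shows "z = w"
proof -
  note ta = signed_measure_parts[OF a] and tb = signed_measure_parts[OF b]
  have meas: "f \<in> \<gamma>P \<rightarrow>\<^sub>M borel" "f \<in> \<gamma>N \<rightarrow>\<^sub>M borel" if "f \<in> borel \<Otimes>\<^sub>M borel \<rightarrow>\<^sub>M borel" for f :: "real \<times> real \<Rightarrow> real"
    using that sP sN by (simp_all cong: measurable_cong_sets)
  have spc: "space \<gamma>P = UNIV" "space \<gamma>N = UNIV"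
    using sP sN by (simp_all add: space_pair_measure cong: sets_eq_imp_space_eq)
  have finP: "finite_measure \<gamma>P" and finN: "finite_measure \<gamma>N"
    by (rule finite_measure_distrD[OF meas(1)[OF measurable_fst]], simp add: fst ta)
      (rule finite_measure_distrD[OF meas(2)[OF measurable_fst]], simp add: fst ta)
  interpret P: finite_measure \<gamma>P by fact
  interpret N: finite_measure \<gamma>N by fact
  have rect: "A \<times> B \<in> sets \<gamma>P" "A \<times> B \<in> sets \<gamma>N" if "A \<in> sets borel" "B \<in> sets borel" for A B :: "real set"
    using that sP sN by auto
  have Iic: "ereal_Iic p \<in> sets borel" for p by measurable
  define G where "G A B = measure \<gamma>P (A \<times> B) + measure \<gamma>N (A \<times> B)" for A B
  have G1: "G (A \<union> A') B = G A B + G A' B"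
    if "A \<in> sets borel" "A' \<in> sets borel" "B \<in> sets borel" "A \<inter> A' = {}" for A A' B
  proof -
    have "(A \<times> B) \<inter> (A' \<times> B) = {}" using that by blast
    then show ?thesis
      using P.finite_measure_Union[of "A \<times> B" "A' \<times> B"] N.finite_measure_Union[of "A \<times> B" "A' \<times> B"] that rect
      by (simp add: G_def Sigma_Un_distrib1)
  qed
  have G2: "G A (B \<union> B') = G A B + G A B'"
    if "A \<in> sets borel" "B \<in> sets borel" "B' \<in> sets borel" "B \<inter> B' = {}" for A B B'
  proof -
    have "(A \<times> B) \<inter> (A \<times> B') = {}" using that by blast
    then show ?thesis
      using P.finite_measure_Union[of "A \<times> B" "A \<times> B'"] N.finite_measure_Union[of "A \<times> B" "A \<times> B'"] that rect
      by (simp add: G_def Sigma_Un_distrib2)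
  qed
  have fstP: "measure \<gamma>P (A \<times> UNIV) = measure (pos_part a) A"
    and fstN: "measure \<gamma>N (A \<times> UNIV) = measure (neg_part a) A"
    and sndP: "measure \<gamma>P (UNIV \<times> A) = measure (pos_part b) A"
    and sndN: "measure \<gamma>N (UNIV \<times> A) = measure (neg_part b) A" if "A \<in> sets borel" for A
    unfolding fst[symmetric] snd[symmetric] using that
    by (simp_all add: measure_distr meas spc vimage_fst vimage_snd)
  have GF: "G A UNIV = measure (total_variation a) A" and GH: "G UNIV A = measure (total_variation b) A"
    if "A \<in> sets borel" for A
    using that by (simp_all add: G_def fstP fstN sndP sndN ta tb)
  define F where "F p = measure (total_variation a) (ereal_Iic p)" for p
  define H where "H q = measure (total_variation b) (ereal_Iic q)" for q
  \<comment> \<open>\<open>F p\<close> and \<open>H q\<close> each add one off-diagonal quadrant to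
    the left-hand side; both quadrants have non-negative mass and one of them has mass 0.\<close>
  have Gmin: "G (ereal_Iic p) (ereal_Iic q) = min (F p) (H q)" for p q
  proof -
    have "F p = G (ereal_Iic p) (ereal_Iic q) + G (ereal_Iic p) (- ereal_Iic q)"
      unfolding F_def GF[OF Iic, symmetric] using G2[of "ereal_Iic p" "ereal_Iic q" "- ereal_Iic q"] by (simp add: Iic borel_comp)
    moreover have "H q = G (ereal_Iic p) (ereal_Iic q) + G (- ereal_Iic p) (ereal_Iic q)"
      unfolding H_def GH[OF Iic, symmetric] using G1[of "ereal_Iic p" "- ereal_Iic p" "ereal_Iic q"] by (simp add: Iic borel_comp)
    moreover have "G (ereal_Iic p) (- ereal_Iic q) = 0 \<or> G (- ereal_Iic p) (ereal_Iic q) = 0"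
      using mono[of p q] by (simp add: G_def)
    moreover have "0 \<le> G (ereal_Iic p) (- ereal_Iic q)" "0 \<le> G (- ereal_Iic p) (ereal_Iic q)"
      by (simp_all add: G_def)
    ultimately show ?thesis by linarith
  qed
  have cell: "0 < G (ereal_Ioc s t) (ereal_Ioc s' t')"
    if st: "s \<le> t" "s' \<le> t'" and overlap: "max (F s) (H s') < min (F t) (H t')" for s t s' t'
  proof -
    have un: "ereal_Iic v = ereal_Iic u \<union> ereal_Ioc u v" "ereal_Iic u \<inter> ereal_Ioc u v = {}"
      if "u \<le> v" for u v using that by (auto simp: ereal_Ioc_def)
    have 1: "G (ereal_Iic t) B = G (ereal_Iic s) B + G (ereal_Ioc s t) B" if "B \<in> sets borel" for B
      by (subst un(1)[OF st(1)], rule G1[OF Iic ereal_Ioc_borel that un(2)[OF st(1)]])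
    have 2: "G A (ereal_Iic t') = G A (ereal_Iic s') + G A (ereal_Ioc s' t')" if "A \<in> sets borel" for A
      by (subst un(1)[OF st(2)], rule G2[OF that Iic ereal_Ioc_borel un(2)[OF st(2)]])
    \<comment> \<open>Inclusion-exclusion over the four corners. Under \<open>overlap\<close> the
      right-hand side equals \<open>min (F t) (H t') - max (F s) (H s')\<close>, the length of the
      overlap.\<close>
    have "G (ereal_Ioc s t) (ereal_Ioc s' t') =
        min (F t) (H t') - min (F s) (H t') - (min (F t) (H s') - min (F s) (H s'))"
      using 1[OF Iic, of t'] 1[OF Iic, of s'] 2[OF ereal_Ioc_borel, of s t] by (simp add: Gmin)
    then show ?thesis using overlap by linarith
  qed
  obtain p where z: "p 0 = -\<infinity>" "p (length z) = \<infinity>" "\<forall>i<length z. p i < p (Suc i)"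
    "\<forall>i<length z. z ! i = a (ereal_Ioc (p i) (p (Suc i)))"
    "\<forall>i<length z. measure (pos_part a) (ereal_Ioc (p i) (p (Suc i))) = 0 \<or>
      measure (neg_part a) (ereal_Ioc (p i) (p (Suc i))) = 0"
    using has_signature_pieces(3)[OF a za] by (elim exE conjE) (rule that)
  note zs = has_signature_pieces(1,2)[OF a za]
  obtain q where w: "q 0 = -\<infinity>" "q (length w) = \<infinity>" "\<forall>i<length w. q i < q (Suc i)"
    "\<forall>i<length w. w ! i = b (ereal_Ioc (q i) (q (Suc i)))"
    "\<forall>i<length w. measure (pos_part b) (ereal_Ioc (q i) (q (Suc i))) = 0 \<or>
      measure (neg_part b) (ereal_Ioc (q i) (q (Suc i))) = 0"
    using has_signature_pieces(3)[OF b wb] by (elim exE conjE) (rule that)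
  note ws = has_signature_pieces(1,2)[OF b wb]
  have sumz: "(\<Sum>i<k. \<bar>z ! i\<bar>) = F (p k)" if "k \<le> length z" for k
    unfolding F_def using signature_partial_sums[of a p "length z" z k, OF a z(1) z(3-5)[rule_format] that] by blast
  have sumw: "(\<Sum>i<k. \<bar>w ! i\<bar>) = H (q k)" if "k \<le> length w" for k
    unfolding H_def using signature_partial_sums[of b q "length w" w k, OF b w(1) w(3-5)[rule_format] that] by blast
  have tot: "(\<Sum>k<length z. \<bar>z ! k\<bar>) = (\<Sum>k<length w. \<bar>w ! k\<bar>)"
    using sumz[of "length z"] sumw[of "length w"] GF[of UNIV] GH[of UNIV] by (simp add: F_def H_def z w)
  have zero: "u = [0]" if "successively (\<lambda>x y. x * y < 0) u" "u \<noteq> []" "(\<Sum>k<length u. \<bar>u ! k\<bar>) = 0" for u :: "real list"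
  proof -
    have "u ! 0 = 0" using that by (subst (asm) sum_nonneg_eq_0_iff) auto
    then have "0 \<in> set u" using that(2) by (metis length_greater_0_conv nth_mem)
    then show ?thesis using successively_sign_change_zero that(1) by blast
  qed
  show "z = w"
  \<comment> \<open>A zero entry forces one list to be \<open>[0]\<close>, so both totals are 0 and
    both lists are \<open>[0]\<close>. Otherwise the combinatorial lemma applies.\<close>
  proof (cases "0 \<in> set z \<or> 0 \<in> set w")
    case True
    then have "z = [0] \<or> w = [0]" using successively_sign_change_zero zs(2) ws(2) by blast
    then have "(\<Sum>k<length z. \<bar>z ! k\<bar>) = 0 \<and> (\<Sum>k<length w. \<bar>w ! k\<bar>) = 0" using tot by auto
    then show ?thesis using zero zs ws by metis
  next
    case False
    show ?thesis
    proof (rule alternating_lists_eq[OF zs(2) ws(2) _ _ tot])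
      fix i j assume i: "i < length z" and j: "j < length w"
        and overlap: "max (\<Sum>k<i. \<bar>z ! k\<bar>) (\<Sum>k<j. \<bar>w ! k\<bar>) < min (\<Sum>k<Suc i. \<bar>z ! k\<bar>) (\<Sum>k<Suc j. \<bar>w ! k\<bar>)"
      let ?A = "ereal_Ioc (p i) (p (Suc i))" and ?B = "ereal_Ioc (q j) (q (Suc j))"
      have "0 < G ?A ?B"
        using overlap i j z(3)[rule_format, OF i] w(3)[rule_format, OF j] by (intro cell) (simp_all only: sumz sumw Suc_leI less_imp_le)
      \<comment> \<open>Mass carried by \<open>\<gamma>P\<close> bounds the positive parts of both
        cells from below, mass carried by \<open>\<gamma>N\<close> the negative parts. Since one
        part is 0 on each cell, this fixes both signs.\<close>
      then have "0 < measure \<gamma>P (?A \<times> ?B) \<or> 0 < measure \<gamma>N (?A \<times> ?B)"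
        unfolding G_def by (smt (verit) measure_nonneg)
      moreover have "measure \<gamma>P (?A \<times> ?B) \<le> measure (pos_part a) ?A"
        "measure \<gamma>P (?A \<times> ?B) \<le> measure (pos_part b) ?B"
        unfolding fstP[OF ereal_Ioc_borel, symmetric] sndP[OF ereal_Ioc_borel, symmetric]
        by (intro P.finite_measure_mono rect; auto)+
      moreover have "measure \<gamma>N (?A \<times> ?B) \<le> measure (neg_part a) ?A"
        "measure \<gamma>N (?A \<times> ?B) \<le> measure (neg_part b) ?B"
        unfolding fstN[OF ereal_Ioc_borel, symmetric] sndN[OF ereal_Ioc_borel, symmetric]
        by (intro N.finite_measure_mono rect; auto)+
      moreover have "z ! i = measure (pos_part a) ?A - measure (neg_part a) ?A"
        "w ! j = measure (pos_part b) ?B - measure (neg_part b) ?B"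
        using z(4)[rule_format, OF i] w(4)[rule_format, OF j] ta(9)[OF ereal_Ioc_borel] tb(9)[OF ereal_Ioc_borel] by simp_all
      moreover note z(5)[rule_format, OF i] w(5)[rule_format, OF j]
      ultimately have "(0 < z ! i \<and> 0 < w ! j) \<or> (z ! i < 0 \<and> w ! j < 0)" by linarith
      then show "0 < z ! i * w ! j" by (auto intro: mult_pos_pos mult_neg_neg)
    qed (use False in auto)
  qed
qed

section \<open>Strictly convex costs\<close>

lemma strictly_convex_borel_measurable:
  assumes "strictly_convex h"
  shows "h \<in> borel_measurable borel"
proof -
  have "convex_on UNIV h"
  proof (rule convex_onI)
    fix t x y :: real assume "0 < t" "t < 1"
    then show "h ((1 - t) *\<^sub>R x + t *\<^sub>R y) \<le> (1 - t) * h x + t * h y"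
      using assms unfolding strictly_convex_def
      by (cases "x = y") (simp_all add: less_imp_le flip: distrib_right)
  qed simp
  then have "continuous_on UNIV h" by (rule convex_on_continuous[OF open_UNIV])
  then show ?thesis by (rule borel_measurable_continuous_onI)
qed

text \<open>The differences \<open>y' - x\<close> and \<open>y - x'\<close> lie strictly between
  \<open>y' - x'\<close> and \<open>y - x\<close> and have the same sum, so they are convex
  combinations with weights exchanged. Adding the two strict convexity inequalities gives the
  claim.\<close>

lemma strictly_convex_monge:
  assumes h: "strictly_convex h" and x: "x < x'" and y: "y' < y"
  shows "h (y' - x) + h (y - x') < h (y - x) + h (y' - x')"
proof -
  define r s t where "r = y' - x'" and "s = y - x" and "t = (x' - x) / (s - r)"
  have rs: "r < s" and t: "0 < t" "t < 1"
    using x y by (auto simp: r_def s_def t_def)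
  have conv: "h ((1 - u) * r + u * s) < (1 - u) * h r + u * h s" if "0 < u" "u < 1" for u
    using h[unfolded strictly_convex_def, rule_format, of r s u] rs that by simp
  have t': "t * (s - r) = x' - x" using rs by (simp add: t_def)
  have e: "y' - x = (1 - t) * r + t * s" "y - x' = (1 - (1 - t)) * r + (1 - t) * s"
    using t' by (simp_all add: algebra_simps) (simp_all add: r_def s_def)
  have "h (y' - x) < (1 - t) * h r + t * h s"
    unfolding e using conv[of t] t by simp
  moreover have "h (y - x') < (1 - (1 - t)) * h r + (1 - t) * h s"
    unfolding e using conv[of "1 - t"] t by simp
  ultimately show ?thesis by (simp add: algebra_simps r_def s_def)
qed

lemma coupling_cost_finite:
  assumes nonneg: "\<And>x y. 0 \<le> c x y" and bound: "\<And>x y. c x y \<le> cX x + cY y"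
    and cpl: "is_coupling \<mu> \<nu> \<gamma>" and int: "integrable \<mu> cX" "integrable \<nu> cY"
  shows "coupling_cost c \<gamma> < \<infinity>"
proof -
  have s: "sets \<gamma> = sets (borel \<Otimes>\<^sub>M borel)" and m: "distr \<gamma> borel fst = \<mu>" "distr \<gamma> borel snd = \<nu>"
    using cpl by (auto simp: is_coupling_def)
  note [measurable_cong] = s
  have "integrable (distr \<gamma> borel fst) cX" "integrable (distr \<gamma> borel snd) cY" using int m by simp_all
  then have "integrable \<gamma> (\<lambda>z. cX (fst z))" "integrable \<gamma> (\<lambda>z. cY (snd z))"
    using integrable_distr[of fst \<gamma> borel cX] integrable_distr[of snd \<gamma> borel cY] by simp_all
  then have I: "integrable \<gamma> (\<lambda>z. cX (fst z) + cY (snd z))" by (rule Bochner_Integration.integrable_add)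
  have "coupling_cost c \<gamma> \<le> (\<integral>\<^sup>+z. ennreal (cX (fst z) + cY (snd z)) \<partial>\<gamma>)"
    unfolding coupling_cost_def by (intro nn_integral_mono ennreal_leI bound)
  \<comment> \<open>\<open>cX\<close> and \<open>cY\<close> may be negative, but their sum dominates
    the non-negative cost, so its truncation to \<open>ennreal\<close> loses nothing.\<close>
  also have "\<dots> < \<infinity>"
    by (subst nn_integral_eq_integral[OF I]) (simp_all add: order.trans[OF nonneg bound])
  finally show ?thesis .
qed

text \<open>A point of the upper left quadrant and one of the lower right quadrant always cross. The
  product of the two quadrants is therefore null for \<gamma> \<otimes> \<gamma>, and its mass is
  the product of their masses.\<close>

lemma optimal_coupling_quadrant_null:
  fixes h :: "real \<Rightarrow> real"
  assumes nonneg: "\<And>t. 0 \<le> h t" and h: "strictly_convex h"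
    and bound: "\<And>x y. h (y - x) \<le> cX x + cY y"
    and opt: "optimal_coupling (\<lambda>x y. h (y - x)) \<mu> \<nu> \<gamma>" and fin: "finite_measure \<mu>"
    and int: "integrable \<mu> cX" "integrable \<nu> cY"
  shows "ereal_Iic p \<times> (- ereal_Iic q) \<in> null_sets \<gamma> \<or> (- ereal_Iic p) \<times> ereal_Iic q \<in> null_sets \<gamma>"
    (is "?U \<in> _ \<or> ?V \<in> _")
proof -
  have cpl: "is_coupling \<mu> \<nu> \<gamma>" using opt by (simp add: optimal_coupling_def)
  then have s: "sets \<gamma> = sets (borel \<Otimes>\<^sub>M borel)" and m: "distr \<gamma> borel fst = \<mu>"
    by (auto simp: is_coupling_def)
  note [measurable_cong] = s
  have finite: "finite_measure \<gamma>"
    by (rule finite_measure_distrD[of fst _ borel]) (simp_all add: m fin)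
  interpret finite_measure \<gamma> by fact
  note [measurable] = strictly_convex_borel_measurable[OF h]
  have "AE u in \<gamma> \<Otimes>\<^sub>M \<gamma>. \<not> discordant u"
  proof (rule optimal_coupling_AE_concordant[OF _ nonneg _ opt finite])
    show "(\<lambda>z. h (snd z - fst z)) \<in> borel_measurable (borel \<Otimes>\<^sub>M borel)" by measurable
    show "coupling_cost (\<lambda>x y. h (y - x)) \<gamma> < \<infinity>" by (rule coupling_cost_finite[OF nonneg bound cpl int])
  qed (rule strictly_convex_monge[OF h])
  then have null: "emeasure (\<gamma> \<Otimes>\<^sub>M \<gamma>) {u \<in> space (\<gamma> \<Otimes>\<^sub>M \<gamma>). discordant u} = 0"
    by (rule emeasure_eq_0_AE)
  have "space \<gamma> = UNIV" using sets_eq_imp_space_eq[OF s] by (simp add: space_pair_measure)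
  moreover have "x < x'" if "ereal x \<le> r" "\<not> ereal x' \<le> r" for x x' r
    using that by (metis ereal_less_eq(3) not_le order.trans)
  ultimately have sub: "?U \<times> ?V \<subseteq> {u \<in> space (\<gamma> \<Otimes>\<^sub>M \<gamma>). discordant u}"
    by (auto simp: space_pair_measure discordant_def)
  have UV: "?U \<in> sets \<gamma>" "?V \<in> sets \<gamma>"
    unfolding s by (intro pair_measureI borel_comp; measurable)+
  have "{u \<in> space (\<gamma> \<Otimes>\<^sub>M \<gamma>). discordant u} \<in> sets (\<gamma> \<Otimes>\<^sub>M \<gamma>)"
    by (rule predE) measurable
  then have "emeasure (\<gamma> \<Otimes>\<^sub>M \<gamma>) (?U \<times> ?V) = 0"
    using emeasure_mono[OF sub, of "\<gamma> \<Otimes>\<^sub>M \<gamma>"] null by simp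
  then show ?thesis using UV by (auto simp: emeasure_pair_measure_Times null_sets_def)
qed

section \<open>Kernels\<close>

lemma is_coupling_kernel_product:
  assumes \<mu>: "sets \<mu> = sets borel" and K: "K \<in> borel \<rightarrow>\<^sub>M prob_algebra borel"
  shows "is_coupling \<mu> (\<mu> \<bind> K) (kernel_product \<mu> K)"
proof -
  have K': "K \<in> \<mu> \<rightarrow>\<^sub>M subprob_algebra borel"
    unfolding measurable_cong_sets[OF \<mu> refl] using K by (rule measurable_prob_algebraD)
  have Kx: "prob_space (K x)" "sets (K x) = sets borel" for x
    using measurable_space[OF K] by (simp_all add: space_prob_algebra)
  then have K1: "emeasure (K x) UNIV = 1" for x
    using prob_space.emeasure_space_1[OF Kx(1)] sets_eq_imp_space_eq[OF Kx(2)] by simp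
  have ne: "space \<mu> \<noteq> {}" using sets_eq_imp_space_eq[OF \<mu>] by simp
  have m: "(\<lambda>x. distr (K x) (borel \<Otimes>\<^sub>M borel) (Pair x)) \<in> \<mu> \<rightarrow>\<^sub>M subprob_algebra (borel \<Otimes>\<^sub>M borel)"
    unfolding measurable_cong_sets[OF \<mu> refl]
    by (rule measurable_distr2[OF _ measurable_prob_algebraD[OF K]]) simp
  have s: "sets (kernel_product \<mu> K) = sets (borel \<Otimes>\<^sub>M borel)"
    unfolding kernel_product_def by (rule sets_bind[OF _ ne]) simp
  note [measurable_cong] = s
  have sp: "space (kernel_product \<mu> K) = UNIV"
    using sets_eq_imp_space_eq[OF s] by (simp add: space_pair_measure)
  have "distr (kernel_product \<mu> K) borel fst = \<mu>"
  proof (rule measure_eqI)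
    fix A assume "A \<in> sets (distr (kernel_product \<mu> K) borel fst)"
    then have A: "A \<in> sets borel" by simp
    then show "emeasure (distr (kernel_product \<mu> K) borel fst) A = emeasure \<mu> A"
      using emeasure_kernel_product[OF \<mu> K A, of UNIV] \<mu>
      by (simp add: emeasure_distr sp vimage_fst K1)
  qed (simp add: \<mu>)
  moreover have "distr (kernel_product \<mu> K) borel snd = \<mu> \<bind> K"
  proof (rule measure_eqI)
    show "sets (distr (kernel_product \<mu> K) borel snd) = sets (\<mu> \<bind> K)"
      using Kx(2) ne by (simp add: sets_bind)
    fix A assume "A \<in> sets (distr (kernel_product \<mu> K) borel snd)"
    then have A: "A \<in> sets borel" by simp
    then show "emeasure (distr (kernel_product \<mu> K) borel snd) A = emeasure (\<mu> \<bind> K) A"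
      using emeasure_kernel_product[OF \<mu> K _ A, of UNIV]
      by (simp add: emeasure_distr sp vimage_snd emeasure_bind[OF ne K' A])
  qed
  ultimately show ?thesis using s by (simp add: is_coupling_def)
qed

lemma fin_borel_measure_bind:
  assumes \<mu>: "fin_borel_measure \<mu>" and K: "K \<in> borel \<rightarrow>\<^sub>M prob_algebra borel"
  shows "fin_borel_measure (\<mu> \<bind> K)"
    and "B \<in> sets borel \<Longrightarrow> measure (\<mu> \<bind> K) B = (LINT x|\<mu>. measure (K x) B)"
    and "measure (\<mu> \<bind> K) UNIV = measure \<mu> UNIV"
proof -
  interpret finite_measure \<mu> using \<mu> by (simp add: fin_borel_measure_def)
  have s: "sets \<mu> = sets borel" using \<mu> by (simp add: fin_borel_measure_def)
  have K': "K \<in> \<mu> \<rightarrow>\<^sub>M subprob_algebra borel"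
    unfolding measurable_cong_sets[OF s refl] using K by (rule measurable_prob_algebraD)
  have Kx: "prob_space (K x)" "sets (K x) = sets borel" for x
    using measurable_space[OF K] by (simp_all add: space_prob_algebra)
  have eK: "emeasure (K x) B = ennreal (measure (K x) B)" for x B
    using Kx(1) by (simp add: finite_measure.emeasure_eq_measure prob_space.finite_measure)
  have ne: "space \<mu> \<noteq> {}" using sets_eq_imp_space_eq[OF s] by simp
  have sp: "space \<mu> = UNIV" using sets_eq_imp_space_eq[OF s] by simp
  have sb: "sets (\<mu> \<bind> K) = sets borel" using Kx(2) ne by (simp add: sets_bind)
  have em: "emeasure (\<mu> \<bind> K) B = (\<integral>\<^sup>+x. ennreal (measure (K x) B) \<partial>\<mu>)" if "B \<in> sets borel" for B
    by (simp add: emeasure_bind[OF ne K' that] eK)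
  show meas: "B \<in> sets borel \<Longrightarrow> measure (\<mu> \<bind> K) B = (LINT x|\<mu>. measure (K x) B)"
  proof -
    assume B: "B \<in> sets borel"
    have "(\<lambda>x. measure (K x) B) \<in> borel_measurable \<mu>"
      using measurable_compose[OF K' measurable_emeasure_subprob_algebra[OF B]] unfolding measure_def
      by measurable
    then have "(LINT x|\<mu>. measure (K x) B) = enn2real (\<integral>\<^sup>+x. ennreal (measure (K x) B) \<partial>\<mu>)"
      by (intro integral_eq_nn_integral) auto
    then show ?thesis by (simp add: measure_def[of "\<mu> \<bind> K"] em[OF B])
  qed
  have K1: "measure (K x) UNIV = 1" for x
    using prob_space.prob_space[OF Kx(1)] sets_eq_imp_space_eq[OF Kx(2)] by simp
  have total: "emeasure (\<mu> \<bind> K) UNIV = emeasure \<mu> UNIV"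
    by (subst em) (simp_all add: K1 sp)
  then show "measure (\<mu> \<bind> K) UNIV = measure \<mu> UNIV" by (simp add: measure_def)
  show "fin_borel_measure (\<mu> \<bind> K)"
    using sb total sets_eq_imp_space_eq[OF sb] by (auto simp: fin_borel_measure_def intro!: finite_measureI)
qed

text \<open>Optimality is applied to |a| as a whole, because monotonicity is needed across the two
  signs and not only within each. As nothing cancels, \<open>K\<close> sends |a| to |b|, so the
  moment conditions bound the cost.\<close>

lemma markov_kernel_signatures_eq:
  fixes h cX cY :: "real \<Rightarrow> real"
  assumes h: "\<And>t. 0 \<le> h t" "strictly_convex h" and bound: "\<And>x y. h (y - x) \<le> cX x + cY y"
    and a: "signed_measure a" and b: "signed_measure b"
    and mass: "measure (total_variation a) UNIV = measure (total_variation b) UNIV"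
    and int: "integrable (total_variation a) cX" "integrable (total_variation b) cY"
    and sig: "has_signature a z" "has_signature b w"
    and opt: "optimal_transport_kernel (\<lambda>x y. h (y - x)) cX cY (Markov_Kernel K)"
    and image: "\<And>B. B \<in> sets borel \<Longrightarrow> kernel_image a (Markov_Kernel K) B = b B"
  shows "z = w"
proof -
  note ta = signed_measure_parts[OF a] and tb = signed_measure_parts[OF b]
  let ?T = "total_variation a" and ?P = "pos_part a" and ?N = "neg_part a"
  have K: "K \<in> borel \<rightarrow>\<^sub>M prob_algebra borel" using opt by simp
  have fin: "fin_borel_measure ?P" "fin_borel_measure ?N" "fin_borel_measure ?T"
    using ta by (auto simp: fin_borel_measure_def)
  have parts: "pos_part b = ?P \<bind> K" "neg_part b = ?N \<bind> K"
  proof -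
    have d: "b B = measure (?P \<bind> K) B - measure (?N \<bind> K) B" if "B \<in> sets borel" for B
      using image[OF that] that by (simp add: signed_integral_def fin_borel_measure_bind(2)[OF fin(1) K]
        fin_borel_measure_bind(2)[OF fin(2) K])
    have m: "measure (?P \<bind> K) UNIV + measure (?N \<bind> K) UNIV = measure (total_variation b) UNIV"
      using mass ta(8)[of UNIV] fin_borel_measure_bind(3)[OF fin(1) K] fin_borel_measure_bind(3)[OF fin(2) K]
      by simp
    show "pos_part b = ?P \<bind> K" "neg_part b = ?N \<bind> K"
      using jordan_decomposition_of_mass_eq[OF b fin_borel_measure_bind(1)[OF fin(1) K]
        fin_borel_measure_bind(1)[OF fin(2) K] d m] by simp_all
  qed
  have cplP: "is_coupling ?P (pos_part b) (kernel_product ?P K)"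
    and cplN: "is_coupling ?N (neg_part b) (kernel_product ?N K)"
    unfolding parts using ta K by (simp_all add: is_coupling_kernel_product)
  have K': "K \<in> borel \<rightarrow>\<^sub>M subprob_algebra borel" using K by (rule measurable_prob_algebraD)
  have mK: "(\<lambda>x. emeasure (K x) B) \<in> borel_measurable borel" if "B \<in> sets borel" for B
    using measurable_compose[OF K' measurable_emeasure_subprob_algebra[OF that]] .
  have TK: "?T \<bind> K = total_variation b"
  proof (rule measure_eqI)
    show s: "sets (?T \<bind> K) = sets (total_variation b)"
      using fin_borel_measure_bind(1)[OF fin(3) K] by (simp add: fin_borel_measure_def)
    fix B assume "B \<in> sets (?T \<bind> K)"
    then have B: "B \<in> sets borel" using s by simp
    have bind: "emeasure (M \<bind> K) B = (\<integral>\<^sup>+x. emeasure (K x) B \<partial>M)" if M: "fin_borel_measure M" for M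
    proof -
      have "sets M = sets borel" using M by (simp add: fin_borel_measure_def)
      moreover from this have "space M \<noteq> {}" using sets_eq_imp_space_eq[of M borel] by simp
      ultimately show ?thesis using K' B by (intro emeasure_bind) (auto cong: measurable_cong_sets)
    qed
    show "emeasure (?T \<bind> K) B = emeasure (total_variation b) B"
      using B by (simp add: bind fin emeasure_total_variation[OF b] parts nn_integral_total_variation[OF a mK])
  qed
  have cplT: "is_coupling ?T (total_variation b) (kernel_product ?T K)"
    using is_coupling_kernel_product[OF _ K, of ?T] by (simp add: TK)
  \<comment> \<open>The kernel product is itself a coupling of finite cost, so the finiteness
    condition in the definition of an optimal kernel holds at |a|.\<close>
  have "transport_cost (\<lambda>x y. h (y - x)) ?T (?T \<bind> K) \<le> coupling_cost (\<lambda>x y. h (y - x)) (kernel_product ?T K)"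
    unfolding transport_cost_def using cplT by (intro INF_lower) (simp add: TK)
  also have "\<dots> < \<infinity>" by (rule coupling_cost_finite[OF h(1) bound cplT int])
  finally have "transport_cost (\<lambda>x y. h (y - x)) ?T (?T \<bind> K) < \<infinity>" .
  then have optT: "optimal_coupling (\<lambda>x y. h (y - x)) ?T (total_variation b) (kernel_product ?T K)"
    using opt fin(3) unfolding TK[symmetric] by simp
  have split: "emeasure (kernel_product ?T K) (A \<times> B) =
      emeasure (kernel_product ?P K) (A \<times> B) + emeasure (kernel_product ?N K) (A \<times> B)"
    if "A \<in> sets borel" "B \<in> sets borel" for A B
  proof -
    have "(\<lambda>x. indicator A x * emeasure (K x) B) \<in> borel_measurable borel"
      using that(1) mK[OF that(2)] by measurable
    then show ?thesis
      using that ta by (simp add: emeasure_kernel_product K nn_integral_total_variation[OF a])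
  qed
  show ?thesis
  proof (rule signatures_eq_of_monotone_coupling[OF a b sig])
    fix p q
    have Iic: "ereal_Iic r \<in> sets borel" for r by measurable
    show "measure (kernel_product ?P K) (ereal_Iic p \<times> (- ereal_Iic q)) +
        measure (kernel_product ?N K) (ereal_Iic p \<times> (- ereal_Iic q)) = 0 \<or>
      measure (kernel_product ?P K) ((- ereal_Iic p) \<times> ereal_Iic q) +
        measure (kernel_product ?N K) ((- ereal_Iic p) \<times> ereal_Iic q) = 0"
      using optimal_coupling_quadrant_null[OF h bound optT ta(7) int, of p q]
        split[OF Iic[of p] borel_comp[OF Iic[of q]]] split[OF borel_comp[OF Iic[of p]] Iic[of q]]
      by (auto simp: null_sets_def measure_def)
  qed (use cplP cplN in \<open>auto simp: is_coupling_def\<close>)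
qed

section \<open>Kernels associated to a coupling\<close>

lemma measure_density_eq_set_integral:
  assumes g: "g \<in> borel_measurable M" and fin: "finite_measure (density M g)" and A: "A \<in> sets M"
  shows "measure (density M g) A = (LINT x:A|M. enn2real (g x))"
    and "set_integrable M A (\<lambda>x. enn2real (g x))"
proof -
  have int: "(\<integral>\<^sup>+x. g x \<partial>M) \<noteq> \<infinity>"
    using finite_measure.emeasure_finite[OF fin, of "space M"] g
    by (simp add: emeasure_density cong: nn_integral_cong)
  \<comment> \<open>\<open>enn2real\<close> sends infinity to 0; since the density has finite
    integral, this alters it only on a null set.\<close>
  have AE: "AE x in M. g x \<noteq> \<infinity>" by (rule nn_integral_PInf_AE[OF g int])
  have m: "(\<lambda>x. indicator A x * enn2real (g x)) \<in> borel_measurable M" using g A by measurable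
  have eq: "(\<integral>\<^sup>+x. ennreal (indicator A x * enn2real (g x)) \<partial>M) = emeasure (density M g) A"
    unfolding emeasure_density[OF g A]
    by (rule nn_integral_cong_AE) (use AE in eventually_elim, auto simp: indicator_def less_top)
  show "measure (density M g) A = (LINT x:A|M. enn2real (g x))"
    unfolding set_lebesgue_integral_def using m
    by (simp add: measure_def eq[symmetric] integral_eq_nn_integral)
  show "set_integrable M A (\<lambda>x. enn2real (g x))"
    unfolding set_integrable_def real_scaleR_def
    using m eq finite_measure.emeasure_finite[OF fin, of A]
    by (intro integrableI_nonneg) (auto simp: less_top)
qed

text \<open>Here \<gamma> itself is monotone. Reweighting it by the densities of the two Jordan
  parts of \<open>a\<close> yields couplings with the Jordan parts of \<open>b\<close>, and these
  inherit the null quadrants of \<gamma>.\<close>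

lemma coupling_kernel_signatures_eq:
  fixes h cX cY :: "real \<Rightarrow> real"
  assumes h: "\<And>t. 0 \<le> h t" "strictly_convex h" and bound: "\<And>x y. h (y - x) \<le> cX x + cY y"
    and a: "signed_measure a" and b: "signed_measure b"
    and mass: "measure (total_variation a) UNIV = measure (total_variation b) UNIV"
    and sig: "has_signature a z" "has_signature b w"
    and opt: "optimal_transport_kernel (\<lambda>x y. h (y - x)) cX cY (Coupling_Kernel \<gamma>)"
    and dom: "in_kernel_domain cX (Coupling_Kernel \<gamma>) a"
    and image: "\<And>B. B \<in> sets borel \<Longrightarrow> kernel_image a (Coupling_Kernel \<gamma>) B = b B"
  shows "z = w"
proof -
  note ta = signed_measure_parts[OF a]
  define \<mu> where "\<mu> = distr \<gamma> borel fst"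
  obtain \<nu> where fin: "finite_measure \<mu>" and optc: "optimal_coupling (\<lambda>x y. h (y - x)) \<mu> \<nu> \<gamma>"
    and int: "integrable \<mu> cX" "integrable \<nu> cY"
    using opt by (auto simp: \<mu>_def optimal_coupling_def is_coupling_def fin_borel_measure_def)
  have s: "sets \<gamma> = sets (borel \<Otimes>\<^sub>M borel)"
    using optc by (simp add: optimal_coupling_def is_coupling_def)
  note [measurable_cong] = s
  have sp: "space \<gamma> = UNIV" using sets_eq_imp_space_eq[OF s] by (simp add: space_pair_measure)
  have s\<mu>: "sets \<mu> = sets borel" by (simp add: \<mu>_def)
  interpret \<mu>: finite_measure \<mu> by fact
  define \<gamma>of where "\<gamma>of P = density \<gamma> (\<lambda>z. RN_deriv \<mu> P (fst z))" for P
  have RN: "RN_deriv \<mu> P \<in> borel_measurable borel" for P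
    using borel_measurable_RN_deriv[of \<mu> P] unfolding measurable_cong_sets[OF s\<mu> refl] .
  have RN': "(\<lambda>z. RN_deriv \<mu> P (fst z)) \<in> borel_measurable \<gamma>" for P
    using RN[of P] by measurable
  have marg: "distr (\<gamma>of P) borel fst = P"
    if "absolutely_continuous \<mu> P" "sets P = sets borel" for P
  proof -
    \<comment> \<open>The weight depends on the left coordinate only, so reweighting commutes with
      projecting to it, and Radon-Nikodym recovers \<open>P\<close>.\<close>
    have "distr (\<gamma>of P) borel fst = density \<mu> (RN_deriv \<mu> P)"
      unfolding \<gamma>of_def \<mu>_def using RN[of P] by (subst density_distr) (simp_all add: \<mu>_def)
    also have "\<dots> = P" by (rule \<mu>.density_RN_deriv) (simp_all add: that s\<mu>)
    finally show ?thesis .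
  qed
  have ac: "absolutely_continuous \<mu> (pos_part a)" "absolutely_continuous \<mu> (neg_part a)"
    using dom ta(3,4) by (auto simp: absolutely_continuous_def null_sets_def \<mu>_def emeasure_total_variation[OF a])
  note fst = marg[OF ac(1) ta(3)] marg[OF ac(2) ta(4)]
  have sof: "sets (\<gamma>of P) = sets (borel \<Otimes>\<^sub>M borel)" "space (\<gamma>of P) = UNIV" for P
    by (simp_all add: \<gamma>of_def s sp)
  note [measurable_cong] = sof(1)
  have finof: "finite_measure (\<gamma>of (pos_part a))" "finite_measure (\<gamma>of (neg_part a))"
    by (rule finite_measure_distrD[of fst _ borel], measurable, simp add: fst ta)+
  let ?Q = "\<lambda>P. distr (\<gamma>of P) borel snd"
  have Q: "measure (?Q P) B = (LINT z:snd -` B|\<gamma>. enn2real (RN_deriv \<mu> P (fst z)))"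
    "set_integrable \<gamma> (snd -` B) (\<lambda>z. enn2real (RN_deriv \<mu> P (fst z)))"
    if P: "finite_measure (\<gamma>of P)" and B: "B \<in> sets borel" for P B
  proof -
    have "snd -` B \<inter> space \<gamma> \<in> sets \<gamma>" by (rule measurable_sets[of snd _ borel]) (use B in simp_all)
    then have A: "snd -` B \<in> sets \<gamma>" by (simp add: sp)
    show "set_integrable \<gamma> (snd -` B) (\<lambda>z. enn2real (RN_deriv \<mu> P (fst z)))"
      by (rule measure_density_eq_set_integral(2)[OF RN' P[unfolded \<gamma>of_def] A])
    show "measure (?Q P) B = (LINT z:snd -` B|\<gamma>. enn2real (RN_deriv \<mu> P (fst z)))"
      using measure_density_eq_set_integral(1)[OF RN' P[unfolded \<gamma>of_def] A] B
      by (simp add: measure_distr sof) (simp add: \<gamma>of_def)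
  qed
  have finQ: "fin_borel_measure (?Q P)" if P: "finite_measure (\<gamma>of P)" for P
    using finite_measure.finite_measure_distr[OF P, of snd borel] by (simp add: fin_borel_measure_def)
  have massQ: "measure (?Q P) UNIV = measure (distr (\<gamma>of P) borel fst) UNIV" for P
    by (simp add: measure_distr sof)
  have diff: "b B = measure (?Q (pos_part a)) B - measure (?Q (neg_part a)) B" if B: "B \<in> sets borel" for B
    using image[OF B] Q[OF finof(1) B] Q[OF finof(2) B]
    by (simp add: signed_RN_deriv_def \<mu>_def[symmetric] set_integral_diff)
  have m: "measure (?Q (pos_part a)) UNIV + measure (?Q (neg_part a)) UNIV = measure (total_variation b) UNIV"
    unfolding massQ fst using mass ta(8)[of UNIV] by simp
  note snd = jordan_decomposition_of_mass_eq[OF b finQ[OF finof(1)] finQ[OF finof(2)] diff m, symmetric]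
  show ?thesis
  proof (rule signatures_eq_of_monotone_coupling[OF a b sig sof(1) sof(1) fst snd])
    fix p q
    have "absolutely_continuous \<gamma> (\<gamma>of P)" for P
      unfolding \<gamma>of_def by (rule absolutely_continuousI_density[OF RN'])
    then have "A \<in> null_sets (\<gamma>of P)" if "A \<in> null_sets \<gamma>" for A P
      using that unfolding absolutely_continuous_def by blast
    then have "measure (\<gamma>of P) A = 0" if "A \<in> null_sets \<gamma>" for A P
      using that by (simp add: measure_eq_0_null_sets)
    then show "measure (\<gamma>of (pos_part a)) (ereal_Iic p \<times> (- ereal_Iic q)) +
        measure (\<gamma>of (neg_part a)) (ereal_Iic p \<times> (- ereal_Iic q)) = 0 \<or>
      measure (\<gamma>of (pos_part a)) ((- ereal_Iic p) \<times> ereal_Iic q) +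
        measure (\<gamma>of (neg_part a)) ((- ereal_Iic p) \<times> ereal_Iic q) = 0"
      using optimal_coupling_quadrant_null[OF h bound optc fin int, of p q] by auto
  qed
qed

theorem theorem5p5:
  fixes h cX cY :: "real \<Rightarrow> real" and a b :: "real set \<Rightarrow> real" and z w :: "real list"
  assumes "\<And>t. 0 \<le> h t" and "strictly_convex h"
    and "cX \<in> borel_measurable borel" and "cY \<in> borel_measurable borel"
    and "\<And>x y. h (y - x) \<le> cX x + cY y"
    and "signed_measure a" and "signed_measure b"
    and "measure (total_variation a) UNIV = measure (total_variation b) UNIV"
    and "a UNIV = b UNIV"
    and "integrable (total_variation a) cX" and "integrable (total_variation b) cY"
    and "has_signature a z" and "has_signature b w" and "z \<noteq> w"
  shows "\<not> (\<exists>K. optimal_transport_kernel (\<lambda>x y. h (y - x)) cX cY K \<and> in_kernel_domain cX K a \<and>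
               (\<forall>B\<in>sets borel. kernel_image a K B = b B))"
proof
  assume "\<exists>K. optimal_transport_kernel (\<lambda>x y. h (y - x)) cX cY K \<and> in_kernel_domain cX K a \<and>
               (\<forall>B\<in>sets borel. kernel_image a K B = b B)"
  then obtain K where K: "optimal_transport_kernel (\<lambda>x y. h (y - x)) cX cY K"
    "in_kernel_domain cX K a" "\<forall>B\<in>sets borel. kernel_image a K B = b B"
    by (elim exE conjE)
  have "z = w"
  proof (cases K)
    case (Markov_Kernel \<kappa>)
    show ?thesis
      by (rule markov_kernel_signatures_eq[OF assms(1,2,5-8,10-13)])
         (use K in \<open>auto simp only: Markov_Kernel\<close>)
  next
    case (Coupling_Kernel \<gamma>)
    show ?thesis
      by (rule coupling_kernel_signatures_eq[OF assms(1,2,5-8,12,13)])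
         (use K in \<open>auto simp only: Coupling_Kernel\<close>)
  qed
  with assms(14) show False ..
qed

end
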